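(* Let $n\geqslant 3$, let $K$ be a convex body in $\mathbb{R}^n$ and let $u,v\in S^{n-1}$. Let $P_u(K)$ and $P_v(K)$ denote the orthogonal projections of $K$ onto $u^{\perp}$ and $v^{\perp}$, and $P_{u,v}(K)$ the orthogonal projection of $K$ onto $(\mathrm{span}\{u,v\})^{\perp}$. Then $$|P_u(K)|\,|P_v(K)|\geqslant \frac{n}{2(n-1)}\sqrt{1-\langle u,v\rangle^2}\,|K|\,|P_{u,v}(K)|.$$ *)

theory Defs
  imports "HOL-Analysis.Analysis"
begin

definition convex_body :: "'a::euclidean_space set \<Rightarrow> bool" where
  "convex_body K \<longleftrightarrow> compact K \<and> convex K \<and> interior K \<noteq> {}"

definition orth_proj :: "'a::euclidean_space set \<Rightarrow> 'a \<Rightarrow> 'a" where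
  "orth_proj W x = (THE y. y \<in> W \<and> (\<forall>w\<in>W. (x - y) \<bullet> w = 0))"

definition orthonormal_basis_of :: "'a::euclidean_space set \<Rightarrow> (nat \<Rightarrow> 'a) \<Rightarrow> bool" where
  "orthonormal_basis_of W b \<longleftrightarrow>
     (\<forall>i<dim W. b i \<in> W \<and> norm (b i) = 1) \<and>
     (\<forall>i<dim W. \<forall>j<dim W. i \<noteq> j \<longrightarrow> b i \<bullet> b j = 0)"

definition subspace_volume :: "'a::euclidean_space set \<Rightarrow> 'a set \<Rightarrow> real" where
  "subspace_volume W S =
     (let b = (SOME b. orthonormal_basis_of W b)
      in measure (PiM {..<dim W} (\<lambda>_. lborel))
           {x \<in> PiE {..<dim W} (\<lambda>_. UNIV). (\<Sum>i<dim W. x i *\<^sub>R b i) \<in> S})"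

definition proj_volume :: "'a::euclidean_space set \<Rightarrow> 'a set \<Rightarrow> real" where
  "proj_volume W K = subspace_volume W (orth_proj W ` K)"

end

theory Submission
  imports Defs "HOL-Probability.Distributions"
begin

text \<open>
  Let \<open>m = n - 2\<close> and \<open>E = (span {u, v})\<^sup>\<bottom>\<close>. For \<open>y \<in> P\<^sub>E K\<close> let \<open>f\<^sub>u y\<close> and \<open>f\<^sub>v y\<close> be the lengths
  of the shadows of the planar section \<open>K\<^sub>y\<close> on \<open>u\<^sup>\<bottom>\<close> and \<open>v\<^sup>\<bottom>\<close>. The section lies in a parallelogram of
  area \<open>f\<^sub>u f\<^sub>v / s\<close>, where \<open>s = sqrt (1 - (u \<bullet> v)\<^sup>2)\<close>, so \<open>s |K| \<le> \<integral> f\<^sub>u f\<^sub>v\<close>, while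
  \<open>|P\<^sub>u K| = \<integral> f\<^sub>u\<close> and \<open>|P\<^sub>v K| = \<integral> f\<^sub>v\<close>. Both functions are concave, so after Cauchy-Schwarz it
  suffices to know Berwald's inequality \<open>(m + 2) |P| \<integral>\<^sub>P f\<^sup>2 \<le> 2 (m + 1) (\<integral>\<^sub>P f)\<^sup>2\<close> for concave \<open>f \<ge> 0\<close>.

  For the latter put \<open>G t = \<integral>\<^sub>r\<^sub>>\<^sub>0 exp (- r) |{y \<in> r P. r f (y / r) \<ge> t}| dr\<close>. By the Prekopa-Leindler
  inequality \<open>G\<close> is log-concave, hence \<open>G 0 * G (s + t) \<le> G s * G t\<close>; integrating this over
  \<open>s, t > 0\<close> gives \<open>G 0 * \<integral> t G t dt \<le> (\<integral> G)\<^sup>2\<close>, and the three quantities are \<open>m! |P|\<close>,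
  \<open>(m + 2)! \<integral> f\<^sup>2 / 2\<close> and \<open>(m + 1)! \<integral> f\<close>.
\<close>

section \<open>The Prekopa-Leindler inequality\<close>

lemma emeasure_lborel_uminus_vimage:
  fixes B :: "real set"
  assumes [measurable]: "B \<in> sets borel"
  shows "emeasure lborel (uminus -` B) = emeasure lborel B"
proof -
  have "uminus -` B \<in> sets borel"
    using measurable_sets[of uminus borel borel B] by simp
  then have "emeasure lborel (uminus -` B) = (\<integral>\<^sup>+x. indicator B (0 + (-1) * x) \<partial>lborel)"
    by (subst nn_integral_indicator[symmetric], simp)
       (rule nn_integral_cong, auto simp: indicator_def)
  also have "\<dots> = (\<integral>\<^sup>+x. indicator B x \<partial>lborel)"
    using nn_integral_real_affine[of "indicator B" "-1" 0] by simp
  finally show ?thesis by simp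
qed

text \<open>Points of \<open>A\<close> climbing to its supremum exhaust \<open>A\<close> except
  possibly for the supremum itself, a null set. This lets Brunn-Minkowski be proved for Borel sets
  without an attained maximum.\<close>

lemma emeasure_lborel_cofinal_sequence:
  fixes A :: "real set"
  assumes [measurable]: "A \<in> sets borel" and "A \<noteq> {}"
  obtains a :: "nat \<Rightarrow> real" where "\<And>i. a i \<in> A" "incseq a"
    "emeasure lborel A = (SUP i. emeasure lborel (A \<inter> {..a i}))"
proof -
  obtain f :: "nat \<Rightarrow> ereal"
    where f: "incseq f" "range f \<subseteq> ereal ` A" "Sup (ereal ` A) = (SUP i. f i)"
    using Sup_countable_SUP[of "ereal ` A"] \<open>A \<noteq> {}\<close> by auto
  then have "\<forall>i. \<exists>a. a \<in> A \<and> f i = ereal a" by blast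
  then obtain a where a: "\<And>i. a i \<in> A" "\<And>i. f i = ereal (a i)" by metis
  have inc: "incseq a" using f(1) a(2) by (auto simp: incseq_def)
  have "A \<subseteq> (\<Union>i. A \<inter> {..a i}) \<union> {real_of_ereal (Sup (ereal ` A))}"
  proof
    fix x assume x: "x \<in> A"
    then have le: "ereal x \<le> Sup (ereal ` A)" by (intro Sup_upper) auto
    show "x \<in> (\<Union>i. A \<inter> {..a i}) \<union> {real_of_ereal (Sup (ereal ` A))}"
    proof (cases "ereal x = Sup (ereal ` A)")
      case True
      then show ?thesis by (metis UnI2 insertI1 real_of_ereal.simps(1))
    next
      case False
      with le have "ereal x < (SUP i. f i)" using f(3) by auto
      then obtain i where "ereal x < f i" by (auto simp: less_SUP_iff)
      then show ?thesis using x a(2) by (auto intro: less_imp_le)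
    qed
  qed
  then have "emeasure lborel A \<le> emeasure lborel ((\<Union>i. A \<inter> {..a i}) \<union> {real_of_ereal (Sup (ereal ` A))})"
    by (intro emeasure_mono) auto
  also have "\<dots> \<le> emeasure lborel (\<Union>i. A \<inter> {..a i}) + emeasure lborel {real_of_ereal (Sup (ereal ` A))}"
    by (intro emeasure_subadditive) auto
  also have "\<dots> = emeasure lborel (\<Union>i. A \<inter> {..a i})" by simp
  finally have "emeasure lborel A \<le> emeasure lborel (\<Union>i. A \<inter> {..a i})" .
  moreover have "emeasure lborel (\<Union>i. A \<inter> {..a i}) \<le> emeasure lborel A"
    by (intro emeasure_mono) auto
  moreover have "(SUP i. emeasure lborel (A \<inter> {..a i})) = emeasure lborel (\<Union>i. A \<inter> {..a i})"
    using inc by (intro SUP_emeasure_incseq) (auto simp: incseq_def intro: order_trans)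
  ultimately show ?thesis using that[OF a(1) inc] by auto
qed

text \<open>For \<open>a\<close> in \<open>A\<close> and \<open>b\<close> in \<open>B\<close>,
  scaled translates of the part of \<open>A\<close> left of \<open>a\<close> and of the part of
  \<open>B\<close> right of \<open>b\<close> both lie in \<open>C\<close>, on opposite sides of one
  point, so their lengths add up. Then \<open>a\<close> tends to the supremum of \<open>A\<close>
  and \<open>b\<close> to the infimum of \<open>B\<close>. A superset \<open>C\<close> replaces the
  Minkowski combination, which need not be Borel.\<close>

lemma brunn_minkowski_real:
  fixes A B C :: "real set"
  assumes [measurable]: "A \<in> sets borel" "B \<in> sets borel" "C \<in> sets borel"
    and "A \<noteq> {}" "B \<noteq> {}" and l: "0 < l" "l < 1"
    and comb: "\<And>x y. x \<in> A \<Longrightarrow> y \<in> B \<Longrightarrow> (1 - l) * x + l * y \<in> C"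
  shows "ennreal (1 - l) * emeasure lborel A + ennreal l * emeasure lborel B \<le> emeasure lborel C"
proof -
  have step: "ennreal (1 - l) * emeasure lborel (A \<inter> {..a}) + ennreal l * emeasure lborel (B \<inter> {b..})
      \<le> emeasure lborel C" if ab: "a \<in> A" "b \<in> B" for a b
  proof -
    \<comment> \<open>The separating point: the first translate ends at \<open>p\<close>, the second
      begins there.\<close>
    define p where "p = (1 - l) * a + l * b"
    have "ennreal (1 - l) * emeasure lborel (A \<inter> {..a})
        \<le> ennreal \<bar>1 - l\<bar> * (\<integral>\<^sup>+x. indicator (C \<inter> {..p}) (l * b + (1 - l) * x) \<partial>lborel)"
    proof -
      have "emeasure lborel (A \<inter> {..a}) = (\<integral>\<^sup>+x. indicator (A \<inter> {..a}) x \<partial>lborel)" by simp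
      also have "\<dots> \<le> (\<integral>\<^sup>+x. indicator (C \<inter> {..p}) (l * b + (1 - l) * x) \<partial>lborel)"
        using l comb[of _ b] ab
        by (intro nn_integral_mono) (auto simp: indicator_def p_def mult_le_cancel_left add.commute)
      finally show ?thesis using l by (auto intro!: mult_left_mono)
    qed
    also have "\<dots> = emeasure lborel (C \<inter> {..p})"
      using l by (subst nn_integral_real_affine[symmetric]) auto
    finally have 1: "ennreal (1 - l) * emeasure lborel (A \<inter> {..a}) \<le> emeasure lborel (C \<inter> {..p})" .
    have "ennreal l * emeasure lborel (B \<inter> {b..})
        \<le> ennreal \<bar>l\<bar> * (\<integral>\<^sup>+x. indicator (C \<inter> {p..}) ((1 - l) * a + l * x) \<partial>lborel)"
    proof -
      have "emeasure lborel (B \<inter> {b..}) = (\<integral>\<^sup>+x. indicator (B \<inter> {b..}) x \<partial>lborel)" by simp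
      also have "\<dots> \<le> (\<integral>\<^sup>+x. indicator (C \<inter> {p..}) ((1 - l) * a + l * x) \<partial>lborel)"
        using l comb[of a] ab
        by (intro nn_integral_mono) (auto simp: indicator_def p_def mult_le_cancel_left)
      finally show ?thesis using l by (auto intro!: mult_left_mono)
    qed
    also have "\<dots> = emeasure lborel (C \<inter> {p..})"
      using l by (subst nn_integral_real_affine[symmetric]) auto
    also have "\<dots> \<le> emeasure lborel (C \<inter> {p<..}) + emeasure lborel {p}"
      by (intro order_trans[OF _ emeasure_subadditive] emeasure_mono) auto
    also have "\<dots> = emeasure lborel (C \<inter> {p<..})" by simp
    finally have 2: "ennreal l * emeasure lborel (B \<inter> {b..}) \<le> emeasure lborel (C \<inter> {p<..})" .
    have "emeasure lborel (C \<inter> {..p}) + emeasure lborel (C \<inter> {p<..})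
        = emeasure lborel ((C \<inter> {..p}) \<union> (C \<inter> {p<..}))"
      by (rule plus_emeasure) auto
    also have "\<dots> \<le> emeasure lborel C" by (rule emeasure_mono) auto
    finally show ?thesis using add_mono[OF 1 2] by order
  qed
  obtain a where a: "\<And>i. a i \<in> A" "incseq a"
    "emeasure lborel A = (SUP i. emeasure lborel (A \<inter> {..a i}))"
    using emeasure_lborel_cofinal_sequence[of A] assms by metis
  \<comment> \<open>Reflection turns the infimum of \<open>B\<close> into a supremum, so the same
    cofinal sequence lemma applies.\<close>
  have mB: "uminus -` B \<in> sets borel"
    using measurable_sets[of uminus borel borel B] by simp
  moreover have "uminus -` B \<noteq> {}"
    using \<open>B \<noteq> {}\<close> by (metis empty_iff equals0I minus_minus vimageI)
  ultimately obtain b where b: "\<And>i. b i \<in> uminus -` B" "incseq b"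
    "emeasure lborel (uminus -` B) = (SUP i. emeasure lborel ((uminus -` B) \<inter> {..b i}))"
    using emeasure_lborel_cofinal_sequence[of "uminus -` B"] by metis
  have "emeasure lborel ((uminus -` B) \<inter> {..t}) = emeasure lborel (B \<inter> {-t..})" for t
    by (subst emeasure_lborel_uminus_vimage[symmetric]) (auto intro!: arg_cong[where f = "emeasure lborel"])
  then have b3: "emeasure lborel B = (SUP i. emeasure lborel (B \<inter> {- b i..}))"
    using b(3) by (simp add: emeasure_lborel_uminus_vimage)
  have "ennreal (1 - l) * emeasure lborel A + ennreal l * emeasure lborel B
     = (SUP i. ennreal (1 - l) * emeasure lborel (A \<inter> {..a i}) + ennreal l * emeasure lborel (B \<inter> {- b i..}))"
    using a(2) b(2) unfolding a(3) b3 SUP_mult_left_ennreal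
    by (intro ennreal_SUP_add[symmetric])
       (fastforce simp: incseq_def minus_le_iff intro!: mult_left_mono emeasure_mono intro: order_trans)+
  also have "\<dots> \<le> emeasure lborel C"
    using step a(1) b(1) by (intro SUP_least) auto
  finally show ?thesis .
qed

text \<open>\<open>geo_mean_le l A B C\<close> expresses \<open>A\<^bsup>1 - l\<^esup> B\<^bsup>l\<^esup> \<le> C\<close>. There is no real power on
  \<^typ>\<open>ennreal\<close>, so the inequality is tested on all smaller positive reals; being strict below,
  this form survives monotone limits and needs no integrability hypotheses.\<close>

definition geo_mean_le :: "real \<Rightarrow> ennreal \<Rightarrow> ennreal \<Rightarrow> ennreal \<Rightarrow> bool" where
  "geo_mean_le l A B C \<longleftrightarrow> (\<forall>a b :: real. 0 < a \<longrightarrow> 0 < b \<longrightarrow> ennreal a < A \<longrightarrow> ennreal b < B \<longrightarrow>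
     ennreal (a powr (1 - l) * b powr l) \<le> C)"

text \<open>After \<open>f\<close> and \<open>g\<close> are scaled to supremum 1, their level sets
  at every height below 1 are nonempty, and Brunn-Minkowski applies to them. Integrating over the
  heights bounds the integral of \<open>h\<close> below by an arithmetic mean, hence by the
  geometric mean.\<close>

lemma prekopa_leindler_real:
  fixes f g h :: "real \<Rightarrow> ennreal"
  assumes [measurable]: "f \<in> borel_measurable borel" "g \<in> borel_measurable borel" "h \<in> borel_measurable borel"
    and l: "0 < l" "l < 1"
    and fgh: "\<And>x y. geo_mean_le l (f x) (g y) (h ((1 - l) * x + l * y))"
  shows "geo_mean_le l (\<integral>\<^sup>+x. f x \<partial>lborel) (\<integral>\<^sup>+x. g x \<partial>lborel) (\<integral>\<^sup>+x. h x \<partial>lborel)"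
  unfolding geo_mean_le_def
proof (intro allI impI)
  fix a b :: real
  assume ab: "0 < a" "0 < b" "ennreal a < (\<integral>\<^sup>+x. f x \<partial>lborel)" "ennreal b < (\<integral>\<^sup>+x. g x \<partial>lborel)"
  \<comment> \<open>Truncation at a large integer keeps the integral above \<open>a\<close>, by the
    strict inequality, and makes the supremum \<open>F\<close> finite. Dividing by \<open>F\<close>
    gives a function with supremum 1.\<close>
  have trunc: "\<exists>\<phi> F. \<phi> \<in> borel_measurable borel \<and> 0 < F \<and> (\<forall>x. 0 \<le> \<phi> x \<and> \<phi> x \<le> 1) \<and>
      (\<forall>t<1. \<exists>x. t < \<phi> x) \<and> (\<forall>x. ennreal (F * \<phi> x) \<le> f x) \<and>
      ennreal (a / F) \<le> (\<integral>\<^sup>+x. ennreal (\<phi> x) \<partial>lborel)"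
    if [measurable]: "f \<in> borel_measurable borel"
      and a: "0 < a" "ennreal a < (\<integral>\<^sup>+x. f x \<partial>lborel)" for f :: "real \<Rightarrow> ennreal" and a
  proof -
    have "(SUP n. min (f x) (of_nat n)) = f x" for x
    proof (rule antisym)
      show "f x \<le> (SUP n. min (f x) (of_nat n))"
      proof (rule le_SUP_iff[THEN iffD2], intro allI impI)
        fix y assume y: "y < f x"
        then have "y < top" by (simp add: order_less_le_trans)
        then obtain n where "y < of_nat n" using ennreal_Ex_less_of_nat by blast
        then show "\<exists>i\<in>UNIV. y < min (f x) (of_nat i)" using y by auto
      qed
    qed (auto intro: SUP_least)
    then have "(\<integral>\<^sup>+x. f x \<partial>lborel) = (\<integral>\<^sup>+x. (SUP n. min (f x) (of_nat n)) \<partial>lborel)" by simp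
    also have "\<dots> = (SUP n. \<integral>\<^sup>+x. min (f x) (of_nat n) \<partial>lborel)"
      by (intro nn_integral_monotone_convergence_SUP)
         (auto simp: incseq_def le_fun_def simp del: min.bounded_iff intro!: min.mono)
    finally obtain n :: nat where n: "ennreal a < (\<integral>\<^sup>+x. min (f x) (of_nat n) \<partial>lborel)"
      using a(2) by (auto simp: less_SUP_iff)
    define \<psi> where "\<psi> x = enn2real (min (f x) (of_nat n))" for x
    have fin: "min (f x) (of_nat n) < top" for x
      by (metis ennreal_of_nat_eq_real_of_nat ennreal_less_top min_less_iff_disj)
    then have \<psi>: "ennreal (\<psi> x) = min (f x) (of_nat n)" for x
      by (simp add: \<psi>_def)
    have \<psi>n: "\<psi> x \<le> real n" for x
      unfolding \<psi>_def by (rule enn2real_leI) (auto simp: ennreal_of_nat_eq_real_of_nat)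
    have \<psi>0: "0 \<le> \<psi> x" for x by (simp add: \<psi>_def)
    have [measurable]: "\<psi> \<in> borel_measurable borel" unfolding \<psi>_def by measurable
    have bdd: "bdd_above (range \<psi>)" using \<psi>n by (auto intro!: bdd_aboveI)
    define F where "F = (SUP x. \<psi> x)"
    have \<psi>F: "\<psi> x \<le> F" for x unfolding F_def by (rule cSUP_upper[OF _ bdd]) simp
    have "0 < F"
    proof (rule ccontr)
      assume "\<not> 0 < F"
      then have "\<psi> x = 0" for x using \<psi>F[of x] \<psi>0[of x] by linarith
      then have "(\<integral>\<^sup>+x. min (f x) (of_nat n) \<partial>lborel) = 0" by (simp add: \<psi>[symmetric])
      then show False using n by simp
    qed
    have int: "(\<integral>\<^sup>+x. ennreal (\<psi> x / F) \<partial>lborel) = (\<integral>\<^sup>+x. ennreal (\<psi> x) \<partial>lborel) / ennreal F"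
      using \<open>0 < F\<close> by (simp add: divide_ennreal[symmetric] \<psi>0 nn_integral_divide)
    show ?thesis
    proof (rule exI[of _ "\<lambda>x. \<psi> x / F"], rule exI[of _ F], intro conjI allI impI)
      show "ennreal (a / F) \<le> (\<integral>\<^sup>+x. ennreal (\<psi> x / F) \<partial>lborel)"
        unfolding int using n \<open>0 < F\<close> a
        by (subst divide_ennreal[symmetric]) (auto simp: \<psi> intro!: divide_right_mono_ennreal)
      fix t :: real assume "t < 1"
      then have "t * F < F" using \<open>0 < F\<close> by simp
      then have "\<exists>x. t * F < \<psi> x"
        using less_cSUP_iff[OF _ bdd, of "t * F"] by (simp add: F_def)
      then show "\<exists>x. t < \<psi> x / F" using \<open>0 < F\<close> by (auto simp: field_simps)
    next
      fix x show "ennreal (F * (\<psi> x / F)) \<le> f x" using \<open>0 < F\<close> by (simp add: \<psi>)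
    qed (use \<open>0 < F\<close> \<psi>0 \<psi>F in \<open>auto simp: field_simps\<close>)
  qed
  obtain \<phi> F where [measurable]: "\<phi> \<in> borel_measurable borel" and F: "0 < F"
    and \<phi>: "\<And>x. 0 \<le> \<phi> x" "\<And>x. \<phi> x \<le> 1" "\<And>t. t < 1 \<Longrightarrow> \<exists>x. t < \<phi> x"
      "\<And>x. ennreal (F * \<phi> x) \<le> f x" "ennreal (a / F) \<le> (\<integral>\<^sup>+x. ennreal (\<phi> x) \<partial>lborel)"
    using trunc[of f a] ab by auto
  obtain \<gamma> G where [measurable]: "\<gamma> \<in> borel_measurable borel" and G: "0 < G"
    and \<gamma>: "\<And>x. 0 \<le> \<gamma> x" "\<And>x. \<gamma> x \<le> 1" "\<And>t. t < 1 \<Longrightarrow> \<exists>x. t < \<gamma> x"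
      "\<And>x. ennreal (G * \<gamma> x) \<le> g x" "ennreal (b / G) \<le> (\<integral>\<^sup>+x. ennreal (\<gamma> x) \<partial>lborel)"
    using trunc[of g b] ab by auto
  \<comment> \<open>The height for \<open>h\<close> that matches the heights \<open>F\<close> and
    \<open>G\<close>.\<close>
  define H where "H = F powr (1 - l) * G powr l"
  have H: "0 < H" using F G by (simp add: H_def)
  have layer: "(\<integral>\<^sup>+x. ennreal (\<phi> x) \<partial>lborel)
      = (\<integral>\<^sup>+t. emeasure lborel {x. t < \<phi> x} * indicator {0<..<1} t \<partial>lborel)"
    if [measurable]: "\<phi> \<in> borel_measurable borel" and \<phi>: "\<And>x. 0 \<le> \<phi> x" "\<And>x. \<phi> x \<le> 1"
    for \<phi> :: "real \<Rightarrow> real"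
  proof -
    have eq: "ennreal (\<phi> x) = (\<integral>\<^sup>+t. indicator {0<..<1} t * indicator {z. t < \<phi> z} x \<partial>lborel)" for x
    proof -
      have "(\<integral>\<^sup>+t. indicator {0<..<1} t * indicator {z. t < \<phi> z} x \<partial>lborel)
          = (\<integral>\<^sup>+t. indicator {0<..<\<phi> x} t \<partial>lborel)"
        using \<phi>[of x] by (intro nn_integral_cong) (auto simp: indicator_def)
      then show ?thesis using \<phi>[of x] by simp
    qed
    have "(\<integral>\<^sup>+x. ennreal (\<phi> x) \<partial>lborel)
       = (\<integral>\<^sup>+t. \<integral>\<^sup>+x. indicator {0<..<1} t * indicator {z. t < \<phi> z} x \<partial>lborel \<partial>lborel)"
      unfolding eq by (rule lborel_pair.Fubini') (simp add: indicator_def)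
    also have "\<dots> = (\<integral>\<^sup>+t. emeasure lborel {x. t < \<phi> x} * indicator {0<..<1} t \<partial>lborel)"
      by (intro nn_integral_cong) (simp add: nn_integral_cmult mult.commute)
    finally show ?thesis .
  qed
  \<comment> \<open>A layer-cake estimate for \<open>h\<close>: only heights below \<open>H\<close>
    are counted, so it is an inequality, valid also where \<open>h\<close> is infinite.\<close>
  have "(\<integral>\<^sup>+t. emeasure lborel {x. ennreal (t * H) \<le> h x} * indicator {0<..<1} t \<partial>lborel) * ennreal H
     \<le> (\<integral>\<^sup>+x. h x \<partial>lborel)"
  proof -
    have "(\<integral>\<^sup>+t. emeasure lborel {x. ennreal (t * H) \<le> h x} * indicator {0<..<1} t \<partial>lborel)
       = (\<integral>\<^sup>+t. \<integral>\<^sup>+x. indicator {0<..<1} t * indicator {z. ennreal (t * H) \<le> h z} x \<partial>lborel \<partial>lborel)"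
      by (intro nn_integral_cong) (simp add: nn_integral_cmult mult.commute)
    also have "\<dots> = (\<integral>\<^sup>+x. \<integral>\<^sup>+t. indicator {0<..<1} t * indicator {z. ennreal (t * H) \<le> h z} x \<partial>lborel \<partial>lborel)"
      by (rule lborel_pair.Fubini') (simp add: indicator_def)
    also have "\<dots> * ennreal H = (\<integral>\<^sup>+x. (\<integral>\<^sup>+t. indicator {0<..<1} t * indicator {z. ennreal (t * H) \<le> h z} x \<partial>lborel) * ennreal H \<partial>lborel)"
      by (rule nn_integral_multc[symmetric]) (simp add: indicator_def)
    also have "\<dots> \<le> (\<integral>\<^sup>+x. h x \<partial>lborel)"
    proof (rule nn_integral_mono)
      fix x
      show "(\<integral>\<^sup>+t. indicator {0<..<1} t * indicator {z. ennreal (t * H) \<le> h z} x \<partial>lborel) * ennreal H \<le> h x"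
      proof (cases "h x")
        case (real r)
        have "(\<integral>\<^sup>+t. indicator {0<..<1} t * indicator {z. ennreal (t * H) \<le> h z} x \<partial>lborel)
            \<le> (\<integral>\<^sup>+t. indicator {0..r / H} t \<partial>lborel)"
          using real H by (intro nn_integral_mono) (auto simp: indicator_def field_simps)
        also have "\<dots> = ennreal (r / H)" using real H by simp
        finally have "(\<integral>\<^sup>+t. indicator {0<..<1} t * indicator {z. ennreal (t * H) \<le> h z} x \<partial>lborel) * ennreal H
            \<le> ennreal (r / H) * ennreal H" by (rule mult_right_mono) simp
        also have "\<dots> = h x" using real H by (simp add: ennreal_mult[symmetric])
        finally show ?thesis .
      qed simp
    qed
    finally show ?thesis .
  qed
  moreover have "ennreal (1 - l) * ennreal (a / F) + ennreal l * ennreal (b / G)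
     \<le> (\<integral>\<^sup>+t. emeasure lborel {x. ennreal (t * H) \<le> h x} * indicator {0<..<1} t \<partial>lborel)"
  proof -
    have "ennreal (1 - l) * ennreal (a / F) + ennreal l * ennreal (b / G)
      \<le> ennreal (1 - l) * (\<integral>\<^sup>+x. ennreal (\<phi> x) \<partial>lborel) + ennreal l * (\<integral>\<^sup>+x. ennreal (\<gamma> x) \<partial>lborel)"
      using \<phi>(5) \<gamma>(5) by (intro add_mono mult_left_mono) auto
    also have "\<dots> = (\<integral>\<^sup>+t. ennreal (1 - l) * (emeasure lborel {x. t < \<phi> x} * indicator {0<..<1} t)
          + ennreal l * (emeasure lborel {x. t < \<gamma> x} * indicator {0<..<1} t) \<partial>lborel)"
      using \<phi>(1,2) \<gamma>(1,2) by (subst nn_integral_add) (auto simp: layer nn_integral_cmult)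
    also have "\<dots> \<le> (\<integral>\<^sup>+t. emeasure lborel {x. ennreal (t * H) \<le> h x} * indicator {0<..<1} t \<partial>lborel)"
    proof (rule nn_integral_mono)
      fix t :: real
      \<comment> \<open>The level sets of \<open>\<phi>\<close> and \<open>\<gamma>\<close> are
        strict because \<open>geo_mean_le\<close> tests only reals strictly below \<open>f x\<close>
        and \<open>g y\<close>.\<close>
      have "ennreal (1 - l) * emeasure lborel {x. t < \<phi> x} + ennreal l * emeasure lborel {x. t < \<gamma> x}
         \<le> emeasure lborel {x. ennreal (t * H) \<le> h x}" if t: "0 < t" "t < 1"
      proof (rule brunn_minkowski_real[OF _ _ _ _ _ l])
        fix x y assume xy: "x \<in> {x. t < \<phi> x}" "y \<in> {x. t < \<gamma> x}"
        have "ennreal (F * t) < ennreal (F * \<phi> x)" "ennreal (G * t) < ennreal (G * \<gamma> y)"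
          using xy t F G by (auto simp: ennreal_less_iff)
        then have "ennreal (F * t) < f x" "ennreal (G * t) < g y"
          using \<phi>(4)[of x] \<gamma>(4)[of y] by order+
        then have "ennreal ((F * t) powr (1 - l) * (G * t) powr l) \<le> h ((1 - l) * x + l * y)"
          using fgh[of x y] t F G by (simp add: geo_mean_le_def)
        also have "(F * t) powr (1 - l) * (G * t) powr l = t * H"
          using t F G by (simp add: H_def powr_mult powr_diff field_simps)
        finally show "(1 - l) * x + l * y \<in> {x. ennreal (t * H) \<le> h x}" by simp
      qed (use \<phi>(3)[OF t(2)] \<gamma>(3)[OF t(2)] in auto)
      then show "ennreal (1 - l) * (emeasure lborel {x. t < \<phi> x} * indicator {0<..<1} t)
          + ennreal l * (emeasure lborel {x. t < \<gamma> x} * indicator {0<..<1} t)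
         \<le> emeasure lborel {x. ennreal (t * H) \<le> h x} * indicator {0<..<1} t"
        by (auto simp: indicator_def)
    qed
    finally show ?thesis .
  qed
  ultimately have "(ennreal (1 - l) * ennreal (a / F) + ennreal l * ennreal (b / G)) * ennreal H
      \<le> (\<integral>\<^sup>+x. h x \<partial>lborel)"
    by (meson mult_right_mono order_trans zero_le)
  moreover have "ennreal (a powr (1 - l) * b powr l)
      \<le> (ennreal (1 - l) * ennreal (a / F) + ennreal l * ennreal (b / G)) * ennreal H"
  proof -
    have "a powr (1 - l) * b powr l = ((a / F) powr (1 - l) * (b / G) powr l) * H"
      using ab F G by (simp add: H_def powr_divide)
    \<comment> \<open>Weighted AM-GM for the normalised integrals; the factor \<open>H\<close>
      restores the scale.\<close>
    also have "\<dots> \<le> ((1 - l) * (a / F) + l * (b / G)) * H"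
      using Youngs_inequality_0[of "1 - l" l "a / F" "b / G"] l ab F G H
      by (intro mult_right_mono) auto
    finally have "ennreal (a powr (1 - l) * b powr l) \<le> ennreal (((1 - l) * (a / F) + l * (b / G)) * H)"
      by (rule ennreal_leI)
    also have "\<dots> = (ennreal (1 - l) * ennreal (a / F) + ennreal l * ennreal (b / G)) * ennreal H"
      using l ab F G H by (simp add: ennreal_mult[symmetric] ennreal_plus[symmetric] del: ennreal_plus)
    finally show ?thesis .
  qed
  ultimately show "ennreal (a powr (1 - l) * b powr l) \<le> (\<integral>\<^sup>+x. h x \<partial>lborel)" by order
qed

section \<open>Product Lebesgue measure on coordinates, and Prekopa-Leindler in \<open>k\<close>
  variables\<close>

abbreviation Leb :: "nat \<Rightarrow> (nat \<Rightarrow> real) measure" where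
  "Leb k \<equiv> PiM {..<k} (\<lambda>_. lborel)"

interpretation lborel_product: product_sigma_finite "\<lambda>_ :: nat. lborel :: real measure"
  by standard

lemma sigma_finite_Leb: "sigma_finite_measure (Leb k)"
  by (rule lborel_product.sigma_finite) simp

lemma space_Leb: "space (Leb k) = PiE {..<k} (\<lambda>_. UNIV)"
  by (simp add: space_PiM)

lemma fun_upd_in_space_Leb: "x \<in> space (Leb k) \<Longrightarrow> x(k := t) \<in> space (Leb (Suc k))"
  by (auto simp: space_Leb PiE_def extensional_def)

lemma measurable_Leb_upd [measurable]:
  "(\<lambda>(x, t). x(k := t)) \<in> Leb k \<Otimes>\<^sub>M borel \<rightarrow>\<^sub>M Leb (Suc k)"
proof -
  have "(\<lambda>(x, t). x(k := t)) \<in> Leb k \<Otimes>\<^sub>M lborel \<rightarrow>\<^sub>M PiM (insert k {..<k}) (\<lambda>_. lborel)"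
    by (rule measurable_add_dim)
  then show ?thesis
    by (simp add: lessThan_Suc cong: measurable_cong_sets)
qed

lemma measurable_Leb_upd' [measurable (raw)]:
  assumes "f \<in> M \<rightarrow>\<^sub>M Leb k" "g \<in> M \<rightarrow>\<^sub>M borel"
  shows "(\<lambda>x. (f x)(k := g x)) \<in> M \<rightarrow>\<^sub>M Leb (Suc k)"
  using measurable_compose[OF measurable_Pair[OF assms] measurable_Leb_upd] by simp

lemma nn_integral_Leb_Suc:
  assumes "f \<in> borel_measurable (Leb (Suc k))"
  shows "(\<integral>\<^sup>+x. f x \<partial>Leb (Suc k)) = (\<integral>\<^sup>+x. \<integral>\<^sup>+t. f (x(k := t)) \<partial>lborel \<partial>Leb k)"
  using lborel_product.product_nn_integral_insert[of "{..<k}" k f] assms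
  by (simp add: lessThan_Suc)

lemma nn_integral_Leb_Suc_rev:
  assumes "f \<in> borel_measurable (Leb (Suc k))"
  shows "(\<integral>\<^sup>+x. f x \<partial>Leb (Suc k)) = (\<integral>\<^sup>+t. \<integral>\<^sup>+x. f (x(k := t)) \<partial>Leb k \<partial>lborel)"
  using lborel_product.product_nn_integral_insert_rev[of "{..<k}" k f] assms
  by (simp add: lessThan_Suc)

lemma nn_integral_PiM_empty: "(\<integral>\<^sup>+x. f x \<partial>PiM {} M) = f (\<lambda>_. undefined)"
  by (simp add: PiM_empty nn_integral_count_space_finite)

lemma measurable_Leb_affine:
  "(\<lambda>x. \<lambda>i\<in>{..<k}. a i + c * x i) \<in> Leb k \<rightarrow>\<^sub>M Leb k"
  by measurable

text \<open>One coordinate at a time, by induction. It serves for translations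
  (\<open>c = 1\<close>), reflection (\<open>c = -1\<close>) and the dilations of the cone in
  Berwald's inequality (\<open>c = 1 / r\<close>).\<close>

lemma nn_integral_Leb_affine:
  assumes "f \<in> borel_measurable (Leb k)" and c: "c \<noteq> 0"
  shows "(\<integral>\<^sup>+x. f x \<partial>Leb k) = ennreal (\<bar>c\<bar> ^ k) * (\<integral>\<^sup>+x. f (\<lambda>i\<in>{..<k}. a i + c * x i) \<partial>Leb k)"
  using assms(1)
proof (induction k arbitrary: f)
  case 0
  then show ?case by (simp add: nn_integral_PiM_empty restrict_def del: nn_integral_const)
next
  case (Suc k)
  note [measurable] = Suc.prems measurable_Leb_affine
  interpret sigma_finite_measure "Leb k" by (rule sigma_finite_Leb)
  have [measurable]: "(\<lambda>p. \<lambda>i\<in>{..<k}. a i + c * fst p i) \<in> Leb k \<Otimes>\<^sub>M lborel \<rightarrow>\<^sub>M Leb k"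
    by (rule measurable_compose[OF measurable_fst measurable_Leb_affine])
  have upd: "(\<lambda>i\<in>{..<Suc k}. a i + c * (x(k := t)) i) = (\<lambda>i\<in>{..<k}. a i + c * x i)(k := a k + c * t)" for x t
    by (auto simp: fun_eq_iff restrict_def)
  have "(\<integral>\<^sup>+x. f x \<partial>Leb (Suc k)) = (\<integral>\<^sup>+x. \<integral>\<^sup>+t. f (x(k := t)) \<partial>lborel \<partial>Leb k)"
    by (rule nn_integral_Leb_Suc) simp
  also have "\<dots> = ennreal (\<bar>c\<bar> ^ k) * (\<integral>\<^sup>+x. \<integral>\<^sup>+t. f ((\<lambda>i\<in>{..<k}. a i + c * x i)(k := t)) \<partial>lborel \<partial>Leb k)"
    by (rule Suc.IH) measurable
  also have "\<dots> = ennreal (\<bar>c\<bar> ^ k) * (\<integral>\<^sup>+x. \<bar>c\<bar> * (\<integral>\<^sup>+t. f ((\<lambda>i\<in>{..<k}. a i + c * x i)(k := a k + c * t)) \<partial>lborel) \<partial>Leb k)"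
    by (intro arg_cong2[where f = "(*)"] refl nn_integral_cong nn_integral_real_affine[OF _ c]) measurable
  also have "\<dots> = ennreal (\<bar>c\<bar> ^ k) * (ennreal \<bar>c\<bar> * (\<integral>\<^sup>+x. (\<integral>\<^sup>+t. f ((\<lambda>i\<in>{..<k}. a i + c * x i)(k := a k + c * t)) \<partial>lborel) \<partial>Leb k))"
    by (intro arg_cong2[where f = "(*)"] refl nn_integral_cmult) measurable
  also have "\<dots> = ennreal (\<bar>c\<bar> ^ Suc k) * (\<integral>\<^sup>+x. f (\<lambda>i\<in>{..<Suc k}. a i + c * x i) \<partial>Leb (Suc k))"
    by (subst nn_integral_Leb_Suc, measurable, subst upd)
       (simp add: mult.assoc[symmetric] ennreal_mult[symmetric] mult.commute)
  finally show ?case .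
qed

text \<open>The restriction to \<open>{..<k}\<close> keeps the result in the space of
  \<open>Leb k\<close>, whose points are \<open>undefined\<close> outside the index range.\<close>

definition convex_comb :: "nat \<Rightarrow> real \<Rightarrow> (nat \<Rightarrow> real) \<Rightarrow> (nat \<Rightarrow> real) \<Rightarrow> nat \<Rightarrow> real" where
  "convex_comb k l x y = (\<lambda>i\<in>{..<k}. (1 - l) * x i + l * y i)"

lemma convex_comb_in_space [simp]: "convex_comb k l x y \<in> space (Leb k)"
  by (simp add: convex_comb_def space_Leb)

lemma convex_comb_upd:
  "convex_comb (Suc k) l (x(k := s)) (y(k := t)) = (convex_comb k l x y)(k := (1 - l) * s + l * t)"
  by (auto simp: convex_comb_def fun_eq_iff restrict_def)

text \<open>Induction by Fubini: the one-dimensional inequality on the fibres of the last coordinate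
  says that the fibre integrals satisfy the hypothesis in \<open>k\<close> variables.\<close>

lemma prekopa_leindler:
  fixes f g h :: "(nat \<Rightarrow> real) \<Rightarrow> ennreal"
  assumes "f \<in> borel_measurable (Leb k)" "g \<in> borel_measurable (Leb k)" "h \<in> borel_measurable (Leb k)"
    and l: "0 < l" "l < 1"
    and "\<And>x y. x \<in> space (Leb k) \<Longrightarrow> y \<in> space (Leb k) \<Longrightarrow>
           geo_mean_le l (f x) (g y) (h (convex_comb k l x y))"
  shows "geo_mean_le l (\<integral>\<^sup>+x. f x \<partial>Leb k) (\<integral>\<^sup>+x. g x \<partial>Leb k) (\<integral>\<^sup>+x. h x \<partial>Leb k)"
  using assms(1-3,6)
proof (induction k arbitrary: f g h)
  case 0
  \<comment> \<open>In dimension 0 the space is the single point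
    \<open>\<lambda>_. undefined\<close>, and integration is evaluation there.\<close>
  have "convex_comb 0 l (\<lambda>_. undefined) (\<lambda>_. undefined) = (\<lambda>_. undefined)"
    by (simp add: convex_comb_def fun_eq_iff)
  then show ?case
    using "0.prems"(4)[of "\<lambda>_. undefined" "\<lambda>_. undefined"] by (simp add: nn_integral_PiM_empty del: nn_integral_const)
next
  case (Suc k)
  note [measurable] = Suc.prems(1-3)
  show ?case
    unfolding nn_integral_Leb_Suc[OF Suc.prems(1)] nn_integral_Leb_Suc[OF Suc.prems(2)]
      nn_integral_Leb_Suc[OF Suc.prems(3)]
  proof (rule Suc.IH)
    fix x y assume [measurable]: "x \<in> space (Leb k)" "y \<in> space (Leb k)"
    show "geo_mean_le l (\<integral>\<^sup>+t. f (x(k := t)) \<partial>lborel) (\<integral>\<^sup>+t. g (y(k := t)) \<partial>lborel)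
        (\<integral>\<^sup>+t. h ((convex_comb k l x y)(k := t)) \<partial>lborel)"
    proof (rule prekopa_leindler_real[OF _ _ _ l])
      fix s t
      show "geo_mean_le l (f (x(k := s))) (g (y(k := t))) (h ((convex_comb k l x y)(k := (1 - l) * s + l * t)))"
        using Suc.prems(4)[OF fun_upd_in_space_Leb fun_upd_in_space_Leb, of x y s t] \<open>x \<in> _\<close> \<open>y \<in> _\<close>
        by (simp only: convex_comb_upd)
    qed measurable
  qed measurable
qed

section \<open>Berwald's inequality\<close>

text \<open>A product in \<open>ennreal\<close> is the supremum of products of strictly smaller,
  hence finite, factors. This converts the test form of \<open>geo_mean_le\<close> back into a plain
  inequality.\<close>

lemma ennreal_mult_leI_strict:
  fixes A B C :: ennreal
  assumes "\<And>a b :: real. 0 < a \<Longrightarrow> 0 < b \<Longrightarrow> ennreal a < A \<Longrightarrow> ennreal b < B \<Longrightarrow> ennreal (a * b) \<le> C"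
  shows "A * B \<le> C"
proof -
  have ab: "a * b \<le> C" if "a < A" "b < B" for a b
  proof (cases "a = 0 \<or> b = 0")
    case False
    with that show ?thesis
      using assms[of "enn2real a" "enn2real b"]
      by (cases a; cases b) (auto simp: ennreal_mult less_le top_unique)
  qed auto
  have "A * B = (SUP a\<in>{..<A}. a) * (SUP b\<in>{..<B}. b)" by simp
  also have "\<dots> = (SUP a\<in>{..<A}. SUP b\<in>{..<B}. a * b)"
    by (subst SUP_mult_right_ennreal, subst SUP_mult_left_ennreal) simp
  also have "\<dots> \<le> C" using ab by (auto intro!: SUP_least)
  finally show ?thesis .
qed

text \<open>The two means have complementary exponents, so in their product both powers become
  1.\<close>

lemma geo_mean_le_mult:
  assumes "geo_mean_le l A B C" "geo_mean_le (1 - l) A B D"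
  shows "A * B \<le> C * D"
proof (rule ennreal_mult_leI_strict)
  fix a b :: real assume ab: "0 < a" "0 < b" "ennreal a < A" "ennreal b < B"
  then have "ennreal (a powr (1 - l) * b powr l) * ennreal (a powr l * b powr (1 - l)) \<le> C * D"
    using assms by (intro mult_mono) (auto simp: geo_mean_le_def)
  also have "ennreal (a powr (1 - l) * b powr l) * ennreal (a powr l * b powr (1 - l)) = ennreal (a * b)"
    using ab by (simp add: ennreal_mult[symmetric] powr_diff)
  finally show "ennreal (a * b) \<le> C * D" .
qed

lemma nn_integral_linear_Ioc:
  fixes c :: real
  assumes "0 \<le> c"
  shows "(\<integral>\<^sup>+t. ennreal t * indicator {0<..c} t \<partial>lborel) = ennreal (c\<^sup>2 / 2)"
proof -
  have "(\<integral>\<^sup>+t. ennreal t * indicator {0<..c} t \<partial>lborel) = (\<integral>\<^sup>+t. ennreal t * indicator {0..c} t \<partial>lborel)"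
    by (intro nn_integral_cong) (auto simp: indicator_def)
  also have "\<dots> = ennreal (c\<^sup>2 / 2 - 0\<^sup>2 / 2)"
    using assms by (intro nn_integral_FTC_Icc) (auto intro!: derivative_eq_intros)
  finally show ?thesis by simp
qed

text \<open>The factor \<open>t\<close> is the length of the interval of \<open>s\<close> between 0
  and \<open>t\<close>; after Tonelli and a shift, the first moment becomes the integral of
  \<open>G (s + t)\<close> over the positive quadrant, where \<open>sub\<close> applies.\<close>

lemma nn_integral_submultiplicative:
  fixes G :: "real \<Rightarrow> ennreal"
  assumes [measurable]: "G \<in> borel_measurable borel"
    and sub: "\<And>s t. 0 < s \<Longrightarrow> 0 < t \<Longrightarrow> G 0 * G (s + t) \<le> G s * G t"
  shows "G 0 * (\<integral>\<^sup>+t. ennreal t * indicator {0<..} t * G t \<partial>lborel)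
      \<le> (\<integral>\<^sup>+t. indicator {0<..} t * G t \<partial>lborel)\<^sup>2"
proof -
  have "ennreal t * indicator {0<..} t * G t
      = (\<integral>\<^sup>+s. indicator {0<..} s * (indicator {0<..} (t - s) * G t) \<partial>lborel)" for t
  proof -
    have "(\<integral>\<^sup>+s. indicator {0<..} s * (indicator {0<..} (t - s) * G t) \<partial>lborel)
        = (\<integral>\<^sup>+s. indicator {0<..<t} s * G t \<partial>lborel)"
      by (intro nn_integral_cong) (auto simp: indicator_def)
    also have "\<dots> = (\<integral>\<^sup>+s. indicator {0<..<t} s \<partial>lborel) * G t" by (rule nn_integral_multc) simp
    also have "\<dots> = ennreal t * indicator {0<..} t * G t" by (cases "0 < t") auto
    finally show ?thesis ..
  qed
  then have "(\<integral>\<^sup>+t. ennreal t * indicator {0<..} t * G t \<partial>lborel)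
     = (\<integral>\<^sup>+t. \<integral>\<^sup>+s. indicator {0<..} s * (indicator {0<..} (t - s) * G t) \<partial>lborel \<partial>lborel)" by simp
  also have "\<dots> = (\<integral>\<^sup>+s. \<integral>\<^sup>+t. indicator {0<..} s * (indicator {0<..} (t - s) * G t) \<partial>lborel \<partial>lborel)"
    by (rule lborel_pair.Fubini') measurable
  also have "\<dots> = (\<integral>\<^sup>+s. \<integral>\<^sup>+t. indicator {0<..} s * (indicator {0<..} t * G (s + t)) \<partial>lborel \<partial>lborel)"
  proof (rule nn_integral_cong)
    fix s :: real
    show "(\<integral>\<^sup>+t. indicator {0<..} s * (indicator {0<..} (t - s) * G t) \<partial>lborel)
        = (\<integral>\<^sup>+t. indicator {0<..} s * (indicator {0<..} t * G (s + t)) \<partial>lborel)"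
      by (subst nn_integral_real_affine[where c = 1 and t = s]) simp_all
  qed
  finally have "G 0 * (\<integral>\<^sup>+t. ennreal t * indicator {0<..} t * G t \<partial>lborel)
     = (\<integral>\<^sup>+s. \<integral>\<^sup>+t. G 0 * (indicator {0<..} s * (indicator {0<..} t * G (s + t))) \<partial>lborel \<partial>lborel)"
    by (simp add: nn_integral_cmult)
  also have "\<dots> \<le> (\<integral>\<^sup>+s. \<integral>\<^sup>+t. (indicator {0<..} s * G s) * (indicator {0<..} t * G t) \<partial>lborel \<partial>lborel)"
    using sub by (intro nn_integral_mono) (auto simp: indicator_def)
  also have "\<dots> = (\<integral>\<^sup>+t. indicator {0<..} t * G t \<partial>lborel)\<^sup>2"
    by (simp add: nn_integral_cmult nn_integral_multc power2_eq_square)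
  finally show ?thesis .
qed

lemma nn_integral_gamma_weight:
  "(\<integral>\<^sup>+r. ennreal (r ^ k * exp (- r)) * indicator {0<..} r \<partial>lborel) = ennreal (fact k)"
proof -
  have "(\<integral>\<^sup>+r. ennreal (r ^ k * exp (- r)) * indicator {0<..} r \<partial>lborel)
      = (\<integral>\<^sup>+r. ennreal (r ^ k * exp (- r)) * indicator {0..} r \<partial>lborel)"
  proof (rule nn_integral_cong_AE)
    show "AE r in lborel. ennreal (r ^ k * exp (- r)) * indicator {0<..} r = ennreal (r ^ k * exp (- r)) * indicator {0..} r"
      using AE_lborel_singleton[of 0] by eventually_elim (simp add: indicator_def)
  qed
  then show ?thesis by (simp only: nn_intergal_power_times_exp_Ici of_nat_fact)
qed

text \<open>The case of exponents 1 and 2. The homogenisation \<open>r * f (y / r)\<close> is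
  concave on the cone over \<open>P\<close>, which is what makes Prekopa-Leindler in
  \<open>m + 1\<close> variables applicable.\<close>

lemma berwald_1_2:
  fixes f :: "(nat \<Rightarrow> real) \<Rightarrow> real"
  assumes P [measurable]: "P \<in> sets (Leb m)" and [measurable]: "f \<in> borel_measurable (Leb m)"
    and conv: "\<And>x y l. x \<in> P \<Longrightarrow> y \<in> P \<Longrightarrow> 0 < l \<Longrightarrow> l < 1 \<Longrightarrow> convex_comb m l x y \<in> P"
    and nonneg: "\<And>x. x \<in> P \<Longrightarrow> 0 \<le> f x"
    and conc: "\<And>x y l. x \<in> P \<Longrightarrow> y \<in> P \<Longrightarrow> 0 < l \<Longrightarrow> l < 1 \<Longrightarrow>
                 (1 - l) * f x + l * f y \<le> f (convex_comb m l x y)"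
  shows "ennreal (m + 2) * (emeasure (Leb m) P * (\<integral>\<^sup>+x. indicator P x * ennreal ((f x)\<^sup>2) \<partial>Leb m))
      \<le> ennreal (2 * (m + 1)) * (\<integral>\<^sup>+x. indicator P x * ennreal (f x) \<partial>Leb m)\<^sup>2"
proof -
  \<comment> \<open>The coordinate \<open>w m\<close> is the height in the cone and \<open>D\<close>
    the radial projection to height 1; \<open>h\<close> below vanishes unless that height is
    positive, so division by 0 does no harm.\<close>
  define D where "D w = (\<lambda>i\<in>{..<m}. w i / w m)" for w :: "nat \<Rightarrow> real"
  have D[measurable]: "D \<in> Leb (Suc m) \<rightarrow>\<^sub>M Leb m"
    unfolding D_def by (intro measurable_restrict) measurable
  define h where "h t w = (if 0 < w m \<and> D w \<in> P \<and> t \<le> w m * f (D w) then ennreal (exp (- w m)) else 0)"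
    for t :: real and w
  have h[measurable]: "h t \<in> borel_measurable (Leb (Suc m))" for t
    unfolding h_def by measurable
  define G where "G t = (\<integral>\<^sup>+w. h t w \<partial>Leb (Suc m))" for t
  define I1 where "I1 = (\<integral>\<^sup>+x. indicator P x * ennreal (f x) \<partial>Leb m)"
  define I2 where "I2 = (\<integral>\<^sup>+x. indicator P x * ennreal ((f x)\<^sup>2) \<partial>Leb m)"
  interpret sigma_finite_measure "Leb m" by (rule sigma_finite_Leb)
  interpret pair_sigma_finite lborel "Leb m" ..
  have logconc: "geo_mean_le l (G s) (G t) (G ((1 - l) * s + l * t))" if l: "0 < l" "l < 1" for l s t
    unfolding G_def
  proof (rule prekopa_leindler[OF h h h l])
    fix x y :: "nat \<Rightarrow> real"
    show "geo_mean_le l (h s x) (h t y) (h ((1 - l) * s + l * t) (convex_comb (Suc m) l x y))"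
      unfolding geo_mean_le_def
    proof (intro allI impI)
      fix a b :: real assume ab: "0 < a" "0 < b" "ennreal a < h s x" "ennreal b < h t y"
      then have x: "0 < x m" "D x \<in> P" "s \<le> x m * f (D x)" "ennreal a < ennreal (exp (- x m))"
        and y: "0 < y m" "D y \<in> P" "t \<le> y m * f (D y)" "ennreal b < ennreal (exp (- y m))"
        by (auto simp: h_def split: if_splits)
      define r where "r = (1 - l) * x m + l * y m"
      \<comment> \<open>Radial projection maps a convex combination to one with reweighted
        coefficients: \<open>k\<close> is the share of \<open>y\<close> in the combined height
        \<open>r\<close>.\<close>
      define k where "k = l * y m / r"
      have r: "0 < r" using l x(1) y(1) by (simp add: r_def add_pos_pos)
      have k: "0 < k" "k < 1" "1 - k = (1 - l) * x m / r"
        using l x(1) y(1) r by (auto simp: k_def divide_simps) (auto simp: r_def algebra_simps)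
      have Dk: "D (convex_comb (Suc m) l x y) = convex_comb m k (D x) (D y)"
      proof
        fix i
        show "D (convex_comb (Suc m) l x y) i = convex_comb m k (D x) (D y) i"
        proof (cases "i < m")
          case True
          have "convex_comb m k (D x) (D y) i = (1 - k) * (x i / x m) + k * (y i / y m)"
            using True by (simp add: convex_comb_def D_def)
          also have "\<dots> = ((1 - l) * x i + l * y i) / r"
            unfolding k(3) using x(1) y(1) by (simp add: k_def add_divide_distrib)
          also have "\<dots> = D (convex_comb (Suc m) l x y) i"
            using True by (simp add: convex_comb_def D_def r_def)
          finally show ?thesis ..
        qed (simp add: D_def convex_comb_def)
      qed
      have rm: "convex_comb (Suc m) l x y m = r" by (simp add: convex_comb_def r_def)
      have "(1 - l) * s + l * t \<le> (1 - l) * (x m * f (D x)) + l * (y m * f (D y))"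
        using l x(3) y(3) by (intro add_mono mult_left_mono) auto
      also have "\<dots> = r * ((1 - k) * f (D x) + k * f (D y))"
        unfolding k(3) using r by (simp add: k_def field_simps)
      also have "\<dots> \<le> r * f (convex_comb m k (D x) (D y))"
        using conc[OF x(2) y(2) k(1,2)] r by simp
      finally have "h ((1 - l) * s + l * t) (convex_comb (Suc m) l x y) = ennreal (exp (- r))"
        using r conv[OF x(2) y(2) k(1,2)] by (simp add: h_def rm Dk)
      moreover have "a powr (1 - l) * b powr l \<le> exp (- x m) powr (1 - l) * exp (- y m) powr l"
        using ab(1,2) x(4) y(4) l by (intro mult_mono powr_mono2) (auto simp: ennreal_less_iff)
      moreover have "exp (- x m) powr (1 - l) * exp (- y m) powr l = exp (- r)"
        by (simp add: powr_def exp_add[symmetric] r_def algebra_simps)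
      ultimately show "ennreal (a powr (1 - l) * b powr l) \<le> h ((1 - l) * s + l * t) (convex_comb (Suc m) l x y)"
        by (simp add: ennreal_leI)
    qed
  qed
  have sub: "G 0 * G (s + t) \<le> G s * G t" if st: "0 < s" "0 < t" for s t
  proof -
    \<comment> \<open>Both \<open>s\<close> and \<open>t\<close> lie between 0 and
      \<open>s + t\<close>, with complementary weights, so the two log-concavity bounds multiply to
      the claim.\<close>
    define l where "l = s / (s + t)"
    have l: "0 < l" "l < 1" "l * (s + t) = s" "(1 - l) * (s + t) = t"
      using st by (auto simp: l_def field_simps)
    show ?thesis
      using geo_mean_le_mult[of l "G 0" "G (s + t)" "G s" "G t"] logconc[of l 0 "s + t"]
        logconc[of "1 - l" 0 "s + t"] l by simp
  qed
  \<comment> \<open>The power \<open>r ^ m\<close> is the Jacobian of the dilation of the slice at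
    height \<open>r\<close> to height 1.\<close>
  define W where "W r = ennreal (r ^ m * exp (- r)) * indicator {0<..} r" for r :: real
  have [measurable]: "W \<in> borel_measurable borel" unfolding W_def by measurable
  have G: "G t = (\<integral>\<^sup>+r. W r * (\<integral>\<^sup>+y. indicator P y * (if t \<le> r * f y then 1 else 0) \<partial>Leb m) \<partial>lborel)" for t
  proof -
    have "G t = (\<integral>\<^sup>+r. \<integral>\<^sup>+y. h t (y(m := r)) \<partial>Leb m \<partial>lborel)"
      unfolding G_def by (rule nn_integral_Leb_Suc_rev) simp
    also have "\<dots> = (\<integral>\<^sup>+r. W r * (\<integral>\<^sup>+y. indicator P y * (if t \<le> r * f y then 1 else 0) \<partial>Leb m) \<partial>lborel)"
    proof (rule nn_integral_cong)
      fix r :: real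
      show "(\<integral>\<^sup>+y. h t (y(m := r)) \<partial>Leb m)
         = W r * (\<integral>\<^sup>+y. indicator P y * (if t \<le> r * f y then 1 else 0) \<partial>Leb m)"
      proof (cases "0 < r")
        case True
        define \<psi> :: "_ \<Rightarrow> ennreal" where "\<psi> y = indicator P y * (if t \<le> r * f y then 1 else 0)" for y
        have [measurable]: "\<psi> \<in> borel_measurable (Leb m)" unfolding \<psi>_def by measurable
        have "D (y(m := r)) = (\<lambda>i\<in>{..<m}. 0 + (1 / r) * y i)" for y
          by (auto simp: D_def fun_eq_iff)
        then have hr: "h t (y(m := r)) = ennreal (exp (- r)) * \<psi> (\<lambda>i\<in>{..<m}. 0 + (1 / r) * y i)" for y
          using True by (simp add: h_def \<psi>_def indicator_def)
        have "W r * (\<integral>\<^sup>+y. \<psi> y \<partial>Leb m) = ennreal (r ^ m * exp (- r)) *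
            (ennreal (\<bar>1 / r\<bar> ^ m) * (\<integral>\<^sup>+y. \<psi> (\<lambda>i\<in>{..<m}. 0 + (1 / r) * y i) \<partial>Leb m))"
          using True by (subst nn_integral_Leb_affine[where a = "\<lambda>_. 0" and c = "1 / r"]) (auto simp: W_def)
        also have "\<dots> = ennreal (exp (- r)) * (\<integral>\<^sup>+y. \<psi> (\<lambda>i\<in>{..<m}. 0 + (1 / r) * y i) \<partial>Leb m)"
          using True by (simp add: mult.assoc[symmetric] ennreal_mult[symmetric] power_one_over)
        also have "\<dots> = (\<integral>\<^sup>+y. h t (y(m := r)) \<partial>Leb m)"
          unfolding hr by (rule nn_integral_cmult[symmetric]) measurable
        finally show ?thesis by (simp add: \<psi>_def)
      qed (simp add: h_def W_def)
    qed
    finally show ?thesis .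
  qed
  have [measurable]: "G \<in> borel_measurable borel" unfolding G by measurable
  \<comment> \<open>Tonelli moves the \<open>t\<close> integral innermost, where it runs up to
    \<open>r * f y\<close>. The weight \<open>V\<close> is later 1, then \<open>t\<close>, on the
    positive axis.\<close>
  have IG: "(\<integral>\<^sup>+t. V t * G t \<partial>lborel)
     = (\<integral>\<^sup>+r. W r * (\<integral>\<^sup>+y. indicator P y * (\<integral>\<^sup>+t. V t * indicator {..r * f y} t \<partial>lborel) \<partial>Leb m) \<partial>lborel)"
    if [measurable]: "V \<in> borel_measurable borel" for V :: "real \<Rightarrow> ennreal"
  proof -
    have "(\<integral>\<^sup>+t. V t * G t \<partial>lborel)
       = (\<integral>\<^sup>+t. \<integral>\<^sup>+r. V t * (W r * (\<integral>\<^sup>+y. indicator P y * (if t \<le> r * f y then 1 else 0) \<partial>Leb m)) \<partial>lborel \<partial>lborel)"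
      unfolding G by (intro nn_integral_cong nn_integral_cmult[symmetric]) measurable
    also have "\<dots> = (\<integral>\<^sup>+r. \<integral>\<^sup>+t. V t * (W r * (\<integral>\<^sup>+y. indicator P y * (if t \<le> r * f y then 1 else 0) \<partial>Leb m)) \<partial>lborel \<partial>lborel)"
      by (rule lborel_pair.Fubini') measurable
    also have "\<dots> = (\<integral>\<^sup>+r. W r * (\<integral>\<^sup>+t. \<integral>\<^sup>+y. V t * (indicator P y * (if t \<le> r * f y then 1 else 0)) \<partial>Leb m \<partial>lborel) \<partial>lborel)"
      by (simp add: nn_integral_cmult mult.left_commute[of "V _" "W _"])
    also have "\<dots> = (\<integral>\<^sup>+r. W r * (\<integral>\<^sup>+y. \<integral>\<^sup>+t. V t * (indicator P y * (if t \<le> r * f y then 1 else 0)) \<partial>lborel \<partial>Leb m) \<partial>lborel)"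
      by (intro nn_integral_cong arg_cong2[where f = "(*)"] refl Fubini'[symmetric]) measurable
    also have "\<dots> = (\<integral>\<^sup>+r. W r * (\<integral>\<^sup>+y. indicator P y * (\<integral>\<^sup>+t. V t * indicator {..r * f y} t \<partial>lborel) \<partial>Leb m) \<partial>lborel)"
      by (intro nn_integral_cong arg_cong2[where f = "(*)"] refl)
         (auto simp: indicator_def intro!: nn_integral_cong)
    finally show ?thesis .
  qed
  have "G 0 = (\<integral>\<^sup>+r. W r * emeasure (Leb m) P \<partial>lborel)"
    unfolding G
  proof (rule nn_integral_cong)
    fix r
    have "(\<integral>\<^sup>+y. indicator P y * (if 0 \<le> r * f y then 1 else 0) \<partial>Leb m) = (\<integral>\<^sup>+y. indicator P y \<partial>Leb m)" if "0 < r"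
      using that nonneg by (intro nn_integral_cong) (auto simp: indicator_def)
    then show "W r * (\<integral>\<^sup>+y. indicator P y * (if 0 \<le> r * f y then 1 else 0) \<partial>Leb m) = W r * emeasure (Leb m) P"
      by (cases "0 < r") (auto simp: W_def)
  qed
  also have "\<dots> = ennreal (fact m) * emeasure (Leb m) P"
    using nn_integral_gamma_weight[of m] by (subst nn_integral_multc, measurable) (simp add: W_def[abs_def])
  finally have G0: "G 0 = ennreal (fact m) * emeasure (Leb m) P" .
  have "(\<integral>\<^sup>+t. indicator {0<..} t * G t \<partial>lborel)
     = (\<integral>\<^sup>+r. ennreal (r ^ Suc m * exp (- r)) * indicator {0<..} r * I1 \<partial>lborel)"
    (is "?L = _")
  proof -
    have "?L = (\<integral>\<^sup>+r. W r * (\<integral>\<^sup>+y. indicator P y *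
        (\<integral>\<^sup>+t. indicator {0<..} t * indicator {..r * f y} t \<partial>lborel) \<partial>Leb m) \<partial>lborel)"
      by (rule IG) measurable
    also have "\<dots> = (\<integral>\<^sup>+r. ennreal (r ^ Suc m * exp (- r)) * indicator {0<..} r * I1 \<partial>lborel)"
    proof (rule nn_integral_cong)
      fix r :: real
      have inner: "indicator P y * (\<integral>\<^sup>+t. indicator {0<..} t * indicator {..r * f y} t \<partial>lborel)
          = ennreal r * (indicator P y * ennreal (f y))" if "0 < r" for y
      proof -
        have "(\<integral>\<^sup>+t. indicator {0<..} t * indicator {..r * f y} t \<partial>lborel) = (\<integral>\<^sup>+t. indicator {0<..r * f y} t \<partial>lborel)"
          by (intro nn_integral_cong) (auto simp: indicator_def)
        then show ?thesis using that nonneg[of y] by (cases "y \<in> P") (simp_all add: ennreal_mult)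
      qed
      show "W r * (\<integral>\<^sup>+y. indicator P y * (\<integral>\<^sup>+t. indicator {0<..} t * indicator {..r * f y} t \<partial>lborel) \<partial>Leb m)
         = ennreal (r ^ Suc m * exp (- r)) * indicator {0<..} r * I1"
      proof (cases "0 < r")
        case True
        then have "ennreal (r ^ Suc m * exp (- r)) = ennreal (r ^ m * exp (- r)) * ennreal r"
          by (subst ennreal_mult[symmetric]) (simp_all add: mult_ac)
        moreover have "(\<integral>\<^sup>+y. indicator P y * (\<integral>\<^sup>+t. indicator {0<..} t * indicator {..r * f y} t \<partial>lborel) \<partial>Leb m) = ennreal r * I1"
          unfolding inner[OF True] I1_def by (rule nn_integral_cmult) measurable
        ultimately show ?thesis
          using True by (simp only: W_def mult.assoc) simp
      qed (simp add: W_def)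
    qed
    finally show ?thesis .
  qed
  also have "\<dots> = ennreal (fact (Suc m)) * I1"
    by (subst nn_integral_multc) (auto simp: nn_integral_gamma_weight simp del: fact_Suc power_Suc)
  finally have G1: "(\<integral>\<^sup>+t. indicator {0<..} t * G t \<partial>lborel) = ennreal (fact (Suc m)) * I1" .
  have "(\<integral>\<^sup>+t. ennreal t * indicator {0<..} t * G t \<partial>lborel)
     = (\<integral>\<^sup>+r. ennreal (r ^ Suc (Suc m) * exp (- r)) * indicator {0<..} r * (ennreal (1 / 2) * I2) \<partial>lborel)"
    (is "?L = _")
  proof -
    have "?L = (\<integral>\<^sup>+r. W r * (\<integral>\<^sup>+y. indicator P y *
        (\<integral>\<^sup>+t. ennreal t * indicator {0<..} t * indicator {..r * f y} t \<partial>lborel) \<partial>Leb m) \<partial>lborel)"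
      by (rule IG) measurable
    also have "\<dots> = (\<integral>\<^sup>+r. ennreal (r ^ Suc (Suc m) * exp (- r)) * indicator {0<..} r * (ennreal (1 / 2) * I2) \<partial>lborel)"
    proof (rule nn_integral_cong)
      fix r :: real
      have inner: "indicator P y * (\<integral>\<^sup>+t. ennreal t * indicator {0<..} t * indicator {..r * f y} t \<partial>lborel)
          = ennreal (r\<^sup>2 / 2) * (indicator P y * ennreal ((f y)\<^sup>2))" if "0 < r" for y
      proof (cases "y \<in> P")
        case True
        have "(\<integral>\<^sup>+t. ennreal t * indicator {0<..} t * indicator {..r * f y} t \<partial>lborel)
            = (\<integral>\<^sup>+t. ennreal t * indicator {0<..r * f y} t \<partial>lborel)"
          by (intro nn_integral_cong) (auto simp: indicator_def)
        also have "\<dots> = ennreal ((r * f y)\<^sup>2 / 2)"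
          using nonneg[OF True] that by (intro nn_integral_linear_Ioc) simp
        finally show ?thesis using True by (simp add: ennreal_mult[symmetric] power_mult_distrib)
      qed simp
      show "W r * (\<integral>\<^sup>+y. indicator P y * (\<integral>\<^sup>+t. ennreal t * indicator {0<..} t * indicator {..r * f y} t \<partial>lborel) \<partial>Leb m)
         = ennreal (r ^ Suc (Suc m) * exp (- r)) * indicator {0<..} r * (ennreal (1 / 2) * I2)"
      proof (cases "0 < r")
        case True
        then have "ennreal (r ^ Suc (Suc m) * exp (- r)) * ennreal (1 / 2) = ennreal (r ^ m * exp (- r)) * ennreal (r\<^sup>2 / 2)"
          by (subst (1 2) ennreal_mult[symmetric]) (simp_all add: power2_eq_square mult_ac)
        moreover have "(\<integral>\<^sup>+y. indicator P y * (\<integral>\<^sup>+t. ennreal t * indicator {0<..} t * indicator {..r * f y} t \<partial>lborel) \<partial>Leb m)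
            = ennreal (r\<^sup>2 / 2) * I2"
          unfolding inner[OF True] I2_def by (rule nn_integral_cmult) measurable
        ultimately show ?thesis
          using True by (simp add: W_def mult.assoc[symmetric] del: power_Suc)
      qed (simp add: W_def)
    qed
    finally show ?thesis .
  qed
  also have "\<dots> = ennreal (fact (Suc (Suc m))) * (ennreal (1 / 2) * I2)"
    by (subst nn_integral_multc) (auto simp: nn_integral_gamma_weight simp del: fact_Suc power_Suc)
  finally have G2: "(\<integral>\<^sup>+t. ennreal t * indicator {0<..} t * G t \<partial>lborel)
     = ennreal (fact (Suc (Suc m))) * (ennreal (1 / 2) * I2)" .
  \<comment> \<open>The common factor: \<open>m! (m+2)! / 2 = c (m+2)\<close> and
    \<open>((m+1)!)^2 = 2 c (m+1)\<close>. Being positive and finite, it cancels in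
    \<open>ennreal\<close>.\<close>
  define c where "c = ennreal (fact m * fact (Suc m) / 2)"
  have "c * (ennreal (m + 2) * (emeasure (Leb m) P * I2))
     = (ennreal (fact m) * emeasure (Leb m) P) * (ennreal (fact (Suc (Suc m))) * (ennreal (1 / 2) * I2))"
  proof -
    have "fact m * fact (Suc m) / 2 * real (m + 2) = fact m * (fact (Suc (Suc m)) * (1 / 2))"
      by (simp add: field_simps)
    then have "c * ennreal (m + 2) = ennreal (fact m * (fact (Suc (Suc m)) * (1 / 2)))"
      unfolding c_def by (subst ennreal_mult[symmetric]) auto
    also have "\<dots> = ennreal (fact m) * (ennreal (fact (Suc (Suc m))) * ennreal (1 / 2))"
      by (subst ennreal_mult[symmetric], simp, simp, subst ennreal_mult[symmetric]) auto
    finally have "c * ennreal (m + 2) * (emeasure (Leb m) P * I2)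
        = ennreal (fact m) * (ennreal (fact (Suc (Suc m))) * ennreal (1 / 2)) * (emeasure (Leb m) P * I2)"
      by (rule arg_cong)
    then show ?thesis by (simp only: mult_ac)
  qed
  also have "\<dots> \<le> (ennreal (fact (Suc m)) * I1)\<^sup>2"
    using nn_integral_submultiplicative[OF _ sub] unfolding G0 G1 G2 by simp
  also have "\<dots> = c * (ennreal (2 * (m + 1)) * I1\<^sup>2)"
  proof -
    have "fact (Suc m) * fact (Suc m) = fact m * fact (Suc m) / 2 * real (2 * (m + 1))"
      by (simp add: field_simps)
    then have "ennreal (fact (Suc m)) * ennreal (fact (Suc m)) = c * ennreal (2 * (m + 1))"
      unfolding c_def by (subst (1 2) ennreal_mult[symmetric]) auto
    then have "ennreal (fact (Suc m)) * ennreal (fact (Suc m)) * (I1 * I1) = c * ennreal (2 * (m + 1)) * (I1 * I1)"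
      by (rule arg_cong)
    then show ?thesis by (simp only: power2_eq_square mult_ac)
  qed
  finally show ?thesis
    unfolding I1_def[symmetric] I2_def[symmetric]
    by (subst (asm) ennreal_mult_le_mult_iff) (auto simp: c_def)
qed

section \<open>Volume in orthonormal coordinates\<close>

definition lin_comb :: "nat \<Rightarrow> (nat \<Rightarrow> 'a::real_vector) \<Rightarrow> (nat \<Rightarrow> real) \<Rightarrow> 'a" where
  "lin_comb k b x = (\<Sum>i<k. x i *\<^sub>R b i)"

lemma measurable_lin_comb [measurable]:
  "lin_comb k (b :: nat \<Rightarrow> 'a::euclidean_space) \<in> Leb k \<rightarrow>\<^sub>M borel"
  unfolding lin_comb_def by measurable

lemma lin_comb_affine:
  "lin_comb k b (\<lambda>i\<in>{..<k}. a i + c * x i) = lin_comb k b a + c *\<^sub>R lin_comb k b x"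
  by (simp add: lin_comb_def scaleR_add_left sum.distrib scaleR_sum_right)

lemma nn_integral_lin_comb_translate:
  fixes b :: "nat \<Rightarrow> 'a::euclidean_space"
  assumes [measurable]: "\<phi> \<in> borel_measurable borel"
  shows "(\<integral>\<^sup>+x. \<phi> (lin_comb k b a + lin_comb k b x) \<partial>Leb k) = (\<integral>\<^sup>+x. \<phi> (lin_comb k b x) \<partial>Leb k)"
  using nn_integral_Leb_affine[of "\<lambda>x. \<phi> (lin_comb k b x)" k 1 a] lin_comb_affine[of k b a 1] by simp

lemma nn_integral_lin_comb_uminus:
  fixes b :: "nat \<Rightarrow> 'a::euclidean_space"
  assumes [measurable]: "\<phi> \<in> borel_measurable borel"
  shows "(\<integral>\<^sup>+x. \<phi> (- lin_comb k b x) \<partial>Leb k) = (\<integral>\<^sup>+x. \<phi> (lin_comb k b x) \<partial>Leb k)"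
proof -
  have "lin_comb k b (\<lambda>i\<in>{..<k}. 0 + (- 1) * x i) = - lin_comb k b x" for x
    using lin_comb_affine[of k b "\<lambda>_. 0" "-1" x] by (simp add: lin_comb_def)
  then show ?thesis
    using nn_integral_Leb_affine[of "\<lambda>x. \<phi> (lin_comb k b x)" k "-1" "\<lambda>_. 0"] by simp
qed

text \<open>The measure inside \<open>subspace_volume\<close> for an explicit frame, kept in
  \<open>ennreal\<close> so that Tonelli needs no finiteness.\<close>

definition coord_volume :: "nat \<Rightarrow> (nat \<Rightarrow> 'a::euclidean_space) \<Rightarrow> 'a set \<Rightarrow> ennreal" where
  "coord_volume k b S = emeasure (Leb k) {x \<in> space (Leb k). lin_comb k b x \<in> S}"

lemma coord_volume_eq_nn_integral:
  assumes [measurable]: "S \<in> sets borel"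
  shows "coord_volume k b S = (\<integral>\<^sup>+x. indicator S (lin_comb k b x) \<partial>Leb k)"
  unfolding coord_volume_def
  by (subst nn_integral_indicator[symmetric], measurable, rule nn_integral_cong) (auto simp: indicator_def)

text \<open>The Fubini argument for uniqueness of Haar measure: both sides are the double integral of
  \<open>indicator A (lin_comb k b x) * indicator B (lin_comb k b x + lin_comb k c y)\<close>.\<close>

lemma coord_volume_exchange:
  fixes b c :: "nat \<Rightarrow> 'a::euclidean_space"
  assumes A [measurable]: "A \<in> sets borel" and B [measurable]: "B \<in> sets borel"
    and same_span: "range (lin_comb k b) = range (lin_comb k c)"
  shows "coord_volume k b A * coord_volume k c B = coord_volume k b B * coord_volume k c A"
proof -
  interpret sigma_finite_measure "Leb k" by (rule sigma_finite_Leb)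
  interpret pair_sigma_finite "Leb k" "Leb k" ..
  \<comment> \<open>Since the spans agree, a shift by a combination of \<open>b\<close> is also one
    of \<open>c\<close>, hence a translation of the coordinates.\<close>
  have trc: "(\<integral>\<^sup>+y. \<phi> (lin_comb k b x + lin_comb k c y) \<partial>Leb k) = (\<integral>\<^sup>+y. \<phi> (lin_comb k c y) \<partial>Leb k)"
    if "\<phi> \<in> borel_measurable borel" for \<phi> and x
  proof -
    obtain a where "lin_comb k b x = lin_comb k c a" using same_span by blast
    then show ?thesis using nn_integral_lin_comb_translate[OF that] by simp
  qed
  have trb: "(\<integral>\<^sup>+x. \<phi> (lin_comb k b x - lin_comb k c y) \<partial>Leb k) = (\<integral>\<^sup>+x. \<phi> (lin_comb k b x) \<partial>Leb k)"
    if "\<phi> \<in> borel_measurable borel" for \<phi> and y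
  proof -
    obtain a where "lin_comb k c y = lin_comb k b a" using same_span by blast
    then have eq: "lin_comb k b x - lin_comb k c y = lin_comb k b (\<lambda>i. - a i) + lin_comb k b x" for x
      by (simp add: lin_comb_def sum_negf)
    show ?thesis unfolding eq by (rule nn_integral_lin_comb_translate[OF that])
  qed
  have "coord_volume k b A * coord_volume k c B
      = (\<integral>\<^sup>+x. indicator A (lin_comb k b x) * coord_volume k c B \<partial>Leb k)"
    unfolding coord_volume_eq_nn_integral[OF A] by (rule nn_integral_multc[symmetric]) measurable
  also have "\<dots> = (\<integral>\<^sup>+x. indicator A (lin_comb k b x) * (\<integral>\<^sup>+y. indicator B (lin_comb k b x + lin_comb k c y) \<partial>Leb k) \<partial>Leb k)"
    by (subst trc) (auto simp: coord_volume_eq_nn_integral)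
  also have "\<dots> = (\<integral>\<^sup>+x. \<integral>\<^sup>+y. indicator A (lin_comb k b x) * indicator B (lin_comb k b x + lin_comb k c y) \<partial>Leb k \<partial>Leb k)"
    by (intro nn_integral_cong nn_integral_cmult[symmetric]) measurable
  also have "\<dots> = (\<integral>\<^sup>+y. \<integral>\<^sup>+x. indicator A (lin_comb k b x) * indicator B (lin_comb k b x + lin_comb k c y) \<partial>Leb k \<partial>Leb k)"
    by (rule Fubini'[symmetric]) measurable
  also have "\<dots> = (\<integral>\<^sup>+y. \<integral>\<^sup>+x. indicator A (lin_comb k b x - lin_comb k c y) * indicator B (lin_comb k b x) \<partial>Leb k \<partial>Leb k)"
  proof (rule nn_integral_cong)
    fix y
    have "(\<lambda>z. indicator A z * indicator B (z + lin_comb k c y) :: ennreal) \<in> borel_measurable borel" by measurable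
    from trb[OF this, of y]
    show "(\<integral>\<^sup>+x. indicator A (lin_comb k b x) * indicator B (lin_comb k b x + lin_comb k c y) \<partial>Leb k)
       = (\<integral>\<^sup>+x. indicator A (lin_comb k b x - lin_comb k c y) * indicator B (lin_comb k b x) \<partial>Leb k)" by simp
  qed
  also have "\<dots> = (\<integral>\<^sup>+x. \<integral>\<^sup>+y. indicator A (lin_comb k b x - lin_comb k c y) * indicator B (lin_comb k b x) \<partial>Leb k \<partial>Leb k)"
    by (rule Fubini') measurable
  also have "\<dots> = (\<integral>\<^sup>+x. (\<integral>\<^sup>+y. indicator A (lin_comb k b x - lin_comb k c y) \<partial>Leb k) * indicator B (lin_comb k b x) \<partial>Leb k)"
    by (intro nn_integral_cong nn_integral_multc) measurable
  also have "\<dots> = (\<integral>\<^sup>+x. coord_volume k c A * indicator B (lin_comb k b x) \<partial>Leb k)"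
  proof (rule nn_integral_cong)
    fix x
    have "(\<integral>\<^sup>+y. indicator A (lin_comb k b x - lin_comb k c y) \<partial>Leb k)
        = (\<integral>\<^sup>+y. indicator A (lin_comb k b x + lin_comb k c y) \<partial>Leb k :: ennreal)"
      using nn_integral_lin_comb_uminus[of "\<lambda>z. indicator A (lin_comb k b x + z)" k c] by simp
    also have "\<dots> = coord_volume k c A"
      by (subst trc) (auto simp: coord_volume_eq_nn_integral)
    finally show "(\<integral>\<^sup>+y. indicator A (lin_comb k b x - lin_comb k c y) \<partial>Leb k) * indicator B (lin_comb k b x)
        = coord_volume k c A * indicator B (lin_comb k b x)" by simp
  qed
  also have "\<dots> = coord_volume k c A * coord_volume k b B"
    unfolding coord_volume_eq_nn_integral[OF B] by (rule nn_integral_cmult) measurable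
  finally show ?thesis by (simp add: mult.commute)
qed

section \<open>Independence of volume from the orthonormal basis\<close>

definition orthonormal_upto :: "nat \<Rightarrow> (nat \<Rightarrow> 'a::euclidean_space) \<Rightarrow> bool" where
  "orthonormal_upto k b \<longleftrightarrow> (\<forall>i<k. \<forall>j<k. b i \<bullet> b j = (if i = j then 1 else 0))"

lemma orthonormal_basis_of_iff:
  "orthonormal_basis_of W b \<longleftrightarrow> (\<forall>i<dim W. b i \<in> W) \<and> orthonormal_upto (dim W) b"
  unfolding orthonormal_basis_of_def orthonormal_upto_def
  by (auto simp: norm_eq_1 split: if_splits)

lemma inner_lin_comb:
  assumes "orthonormal_upto k b" "j < k"
  shows "lin_comb k b x \<bullet> b j = x j"
proof -
  have "lin_comb k b x \<bullet> b j = (\<Sum>i<k. x i * (if i = j then 1 else 0))"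
    using assms by (auto simp: lin_comb_def inner_sum_left orthonormal_upto_def intro!: sum.cong)
  also have "\<dots> = (\<Sum>i<k. if i = j then x i else 0)" by (rule sum.cong) auto
  finally show ?thesis using assms by simp
qed

lemma norm_lin_comb_squared:
  assumes "orthonormal_upto k b"
  shows "(norm (lin_comb k b x))\<^sup>2 = (\<Sum>i<k. (x i)\<^sup>2)"
proof -
  have "(norm (lin_comb k b x))\<^sup>2 = lin_comb k b x \<bullet> (\<Sum>i<k. x i *\<^sub>R b i)"
    by (simp add: power2_norm_eq_inner lin_comb_def)
  also have "\<dots> = (\<Sum>i<k. (x i)\<^sup>2)"
    using inner_lin_comb[OF assms] by (simp add: inner_sum_right power2_eq_square)
  finally show ?thesis .
qed

text \<open>\<open>orthonormal_basis_of\<close> does not ask for spanning. It follows by counting: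
  \<open>dim W\<close> orthonormal vectors in \<open>W\<close> are independent and so span
  it.\<close>

lemma orthonormal_upto_span:
  assumes W: "subspace W" and b: "orthonormal_basis_of W b" and "w \<in> W"
  shows "w = lin_comb (dim W) b (\<lambda>i. w \<bullet> b i)"
proof -
  have on: "orthonormal_upto (dim W) b" and bW: "b ` {..<dim W} \<subseteq> W"
    using b by (auto simp: orthonormal_basis_of_iff)
  have inj: "inj_on b {..<dim W}"
    using on by (auto simp: inj_on_def orthonormal_upto_def) (metis zero_neq_one)
  have "pairwise orthogonal (b ` {..<dim W})" "0 \<notin> b ` {..<dim W}"
    using on by (auto simp: pairwise_def orthogonal_def orthonormal_upto_def) (metis inner_zero_left zero_neq_one)+
  then have "independent (b ` {..<dim W})" by (rule pairwise_orthogonal_independent)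
  then have "W \<subseteq> span (b ` {..<dim W})"
    using card_image[OF inj] bW by (intro card_ge_dim_independent) auto
  then have "w \<in> span (b ` {..<dim W})" using \<open>w \<in> W\<close> by auto
  then obtain r where "w = (\<Sum>v\<in>b ` {..<dim W}. r v *\<^sub>R v)" by (auto simp: span_finite)
  then have w: "w = lin_comb (dim W) b (\<lambda>i. r (b i))"
    by (simp add: lin_comb_def sum.reindex[OF inj])
  then have "w \<bullet> b i = r (b i)" if "i < dim W" for i
    using inner_lin_comb[OF on that] by simp
  then show ?thesis using w by (simp add: lin_comb_def)
qed

lemma range_lin_comb:
  assumes W: "subspace W" and b: "orthonormal_basis_of W b"
  shows "range (lin_comb (dim W) b) = W"
proof
  show "range (lin_comb (dim W) b) \<subseteq> W"
    using b W by (auto simp: lin_comb_def orthonormal_basis_of_iff intro!: subspace_sum subspace_scale)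
  show "W \<subseteq> range (lin_comb (dim W) b)"
    using orthonormal_upto_span[OF assms] by blast
qed

lemma emeasure_Leb_cube:
  assumes "0 \<le> r"
  shows "emeasure (Leb k) (PiE {..<k} (\<lambda>_. {- r..r})) = ennreal ((2 * r) ^ k)"
  using assms by (subst lborel_product.emeasure_PiM) (auto simp: ennreal_power)

text \<open>Each coordinate is an inner product with a unit vector, so a bounded set has its
  coordinates in a cube.\<close>

lemma coord_volume_bounded_finite:
  assumes "orthonormal_upto k b" "bounded S"
  shows "coord_volume k b S < top"
proof -
  obtain r where r: "0 < r" "\<And>x. x \<in> S \<Longrightarrow> norm x \<le> r"
    using \<open>bounded S\<close> by (auto simp: bounded_pos)
  have "{x \<in> space (Leb k). lin_comb k b x \<in> S} \<subseteq> PiE {..<k} (\<lambda>_. {- r..r})"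
  proof
    fix x assume x: "x \<in> {x \<in> space (Leb k). lin_comb k b x \<in> S}"
    have "\<bar>x i\<bar> \<le> r" if "i < k" for i
    proof -
      have "norm (b i) = 1" using assms(1) that by (simp add: orthonormal_upto_def norm_eq_1)
      then have "\<bar>x i\<bar> \<le> norm (lin_comb k b x)"
        using Cauchy_Schwarz_ineq2[of "lin_comb k b x" "b i"] inner_lin_comb[OF assms(1) that, of x] by simp
      then show ?thesis using r(2)[of "lin_comb k b x"] x by auto
    qed
    then show "x \<in> PiE {..<k} (\<lambda>_. {- r..r})"
      using x by (auto simp: space_Leb PiE_iff abs_le_iff minus_le_iff)
  qed
  then have "coord_volume k b S \<le> emeasure (Leb k) (PiE {..<k} (\<lambda>_. {- r..r}))"
    unfolding coord_volume_def by (rule emeasure_mono) (auto intro!: sets_PiM_I_finite)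
  also have "\<dots> < top" using r(1) by (simp add: emeasure_Leb_cube)
  finally show ?thesis .
qed

lemma coord_volume_unit_ball_pos:
  assumes "orthonormal_upto k b"
  shows "0 < coord_volume k b (cball 0 1)"
proof -
  \<comment> \<open>With this side, \<open>k\<close> terms of norm at most \<open>r\<close> sum to
    at most 1; \<open>Suc\<close> covers \<open>k = 0\<close>.\<close>
  define r where "r = 1 / real (Suc k)"
  have r: "0 < r" by (simp add: r_def)
  have "PiE {..<k} (\<lambda>_. {- r..r}) \<subseteq> {x \<in> space (Leb k). lin_comb k b x \<in> cball 0 1}"
  proof
    fix x assume x: "x \<in> PiE {..<k} (\<lambda>_. {- r..r})"
    have "norm (lin_comb k b x) \<le> (\<Sum>i<k. r)"
      unfolding lin_comb_def
    proof (rule sum_norm_le)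
      fix i assume i: "i \<in> {..<k}"
      then have "norm (b i) = 1" using assms by (simp add: orthonormal_upto_def norm_eq_1)
      then show "norm (x i *\<^sub>R b i) \<le> r" using x i by (auto simp: PiE_iff abs_le_iff minus_le_iff)
    qed
    also have "\<dots> \<le> 1" by (simp add: r_def)
    finally show "x \<in> {x \<in> space (Leb k). lin_comb k b x \<in> cball 0 1}"
      using x by (auto simp: space_Leb PiE_iff)
  qed
  then have "emeasure (Leb k) (PiE {..<k} (\<lambda>_. {- r..r})) \<le> coord_volume k b (cball 0 1)"
    unfolding coord_volume_def
    by (rule emeasure_mono) (rule measurable_sets_Collect[OF measurable_lin_comb], simp)
  moreover have "0 < emeasure (Leb k) (PiE {..<k} (\<lambda>_. {- r..r}))"
    using r by (simp add: emeasure_Leb_cube)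
  ultimately show ?thesis by order
qed

text \<open>The unit ball has the same coordinate set in every orthonormal frame, and its volume is
  positive and finite; it can therefore be cancelled from the exchange identity.\<close>

lemma coord_volume_cong_basis:
  assumes W: "subspace W" and b: "orthonormal_basis_of W b" and c: "orthonormal_basis_of W c"
    and S: "S \<in> sets borel"
  shows "coord_volume (dim W) b S = coord_volume (dim W) c S"
proof -
  let ?k = "dim W"
  have on: "orthonormal_upto ?k b" "orthonormal_upto ?k c"
    using b c by (auto simp: orthonormal_basis_of_iff)
  have "norm (lin_comb ?k b x) = norm (lin_comb ?k c x)" for x
    using norm_lin_comb_squared[OF on(1), of x] norm_lin_comb_squared[OF on(2), of x]
    by (metis norm_ge_zero power2_eq_iff_nonneg)
  then have "coord_volume ?k b (cball 0 1) = coord_volume ?k c (cball 0 1)"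
    by (simp add: coord_volume_def)
  moreover have "coord_volume ?k b S * coord_volume ?k c (cball 0 1)
      = coord_volume ?k b (cball 0 1) * coord_volume ?k c S"
    using coord_volume_exchange[OF S, of "cball 0 1" ?k b c] range_lin_comb[OF W] b c by simp
  ultimately have "coord_volume ?k c (cball 0 1) * coord_volume ?k b S
      = coord_volume ?k c (cball 0 1) * coord_volume ?k c S" by (simp add: mult.commute)
  then show ?thesis
    using coord_volume_unit_ball_pos[OF on(2)] coord_volume_bounded_finite[OF on(2) bounded_cball, of 0 1]
    by (auto simp: ennreal_mult_cancel_left)
qed

lemma orthonormal_basis_of_exists:
  assumes "subspace W"
  obtains b where "orthonormal_basis_of W b"
proof -
  obtain B where B: "B \<subseteq> W" "pairwise orthogonal B" "\<And>x. x \<in> B \<Longrightarrow> norm x = 1"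
      "independent B" "card B = dim W"
    using orthonormal_basis_subspace[OF assms] by metis
  have "finite B" using B(4) independent_imp_finite by blast
  then obtain b where b: "bij_betw b {0..<card B} B"
    using ex_bij_betw_nat_finite by blast
  have "orthonormal_basis_of W b"
    unfolding orthonormal_basis_of_def
  proof (intro conjI allI impI)
    fix i j assume ij: "i < dim W" "j < dim W" "i \<noteq> j"
    then have "b i \<in> B" "b j \<in> B" "b i \<noteq> b j"
      using b B(5) by (auto simp: bij_betw_def inj_on_def)
    then show "b i \<bullet> b j = 0" using B(2) by (auto simp: pairwise_def orthogonal_def)
  qed (use b B in \<open>auto simp: bij_betw_def\<close>)
  then show ?thesis by (rule that)
qed

text \<open>Removes the \<open>SOME\<close> from the definition, so that each hyperplane can use a
  basis extending one of the common subspace.\<close>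

lemma subspace_volume_eq:
  assumes W: "subspace W" and c: "orthonormal_basis_of W c" and S: "S \<in> sets borel"
  shows "subspace_volume W S = enn2real (coord_volume (dim W) c S)"
proof -
  define b where "b = (SOME b. orthonormal_basis_of W b)"
  have "orthonormal_basis_of W b" unfolding b_def using someI[of "orthonormal_basis_of W", OF c] by simp
  then have "coord_volume (dim W) b S = coord_volume (dim W) c S"
    using coord_volume_cong_basis W c S by blast
  then show ?thesis
    unfolding subspace_volume_def b_def[symmetric] Let_def measure_def coord_volume_def lin_comb_def
    by (simp add: space_Leb)
qed

text \<open>In an enumeration of \<open>Basis\<close> boxes correspond to products of intervals,
  which identifies \<open>lborel\<close>; basis independence then gives any other orthonormal
  frame.\<close>

lemma emeasure_lborel_eq_coord_volume:
  fixes S :: "'a::euclidean_space set"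
  assumes c: "orthonormal_upto DIM('a) c" and S [measurable]: "S \<in> sets borel"
  shows "emeasure lborel S = coord_volume DIM('a) c S"
proof -
  obtain d :: "nat \<Rightarrow> 'a" where d: "bij_betw d {0..<DIM('a)} Basis"
    using ex_bij_betw_nat_finite[of "Basis :: 'a set"] by auto
  then have dB: "d i \<in> Basis" if "i < DIM('a)" for i using that by (auto simp: bij_betw_def)
  have on: "orthonormal_upto DIM('a) d"
    unfolding orthonormal_upto_def
  proof (intro allI impI)
    fix i j assume "i < DIM('a)" "j < DIM('a)"
    then show "d i \<bullet> d j = (if i = j then 1 else 0)"
      using dB[of i] dB[of j] inj_onD[OF bij_betw_imp_inj_on[OF d], of i j] by (auto simp: inner_Basis)
  qed
  have "lborel = distr (Leb DIM('a)) borel (lin_comb DIM('a) d)"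
  proof (rule lborel_eqI)
    fix l u :: 'a assume lu: "\<And>b. b \<in> Basis \<Longrightarrow> l \<bullet> b \<le> u \<bullet> b"
    have all: "(\<forall>b\<in>Basis. Q b) \<longleftrightarrow> (\<forall>i<DIM('a). Q (d i))" for Q
      using d by (force simp: bij_betw_def)
    have "lin_comb DIM('a) d x \<in> box l u \<longleftrightarrow> (\<forall>i<DIM('a). x i \<in> {l \<bullet> d i<..<u \<bullet> d i})" for x
      unfolding mem_box all using inner_lin_comb[OF on] by auto
    then have "lin_comb DIM('a) d -` box l u \<inter> space (Leb DIM('a))
        = PiE {..<DIM('a)} (\<lambda>i. {l \<bullet> d i<..<u \<bullet> d i})"
      unfolding space_Leb by (intro set_eqI) (simp only: Int_iff vimage_eq PiE_iff, blast)
    then have "emeasure (distr (Leb DIM('a)) borel (lin_comb DIM('a) d)) (box l u)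
        = emeasure (Leb DIM('a)) (PiE {..<DIM('a)} (\<lambda>i. {l \<bullet> d i<..<u \<bullet> d i}))"
      by (subst emeasure_distr) auto
    also have "\<dots> = (\<Prod>i<DIM('a). ennreal ((u - l) \<bullet> d i))"
      using lu dB by (subst lborel_product.emeasure_PiM) (auto simp: inner_diff_left intro!: prod.cong)
    also have "\<dots> = ennreal (\<Prod>i<DIM('a). (u - l) \<bullet> d i)"
      using lu dB by (intro prod_ennreal) (auto simp: inner_diff_left)
    also have "(\<Prod>i<DIM('a). (u - l) \<bullet> d i) = (\<Prod>b\<in>Basis. (u - l) \<bullet> b)"
      using prod.reindex_bij_betw[OF d, of "\<lambda>b. (u - l) \<bullet> b"] by (simp add: atLeast0LessThan)
    finally show "emeasure (distr (Leb DIM('a)) borel (lin_comb DIM('a) d)) (box l u)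
        = ennreal (\<Prod>b\<in>Basis. (u - l) \<bullet> b)" .
  qed simp
  then have "emeasure lborel S = emeasure (distr (Leb DIM('a)) borel (lin_comb DIM('a) d)) S" by simp
  also have "\<dots> = coord_volume DIM('a) d S"
    by (subst emeasure_distr) (auto simp: coord_volume_def vimage_def Int_def conj_commute)
  also have "\<dots> = coord_volume DIM('a) c S"
    using coord_volume_cong_basis[of UNIV d c S] on c by (simp add: orthonormal_basis_of_iff)
  finally show ?thesis .
qed

lemma orth_proj_eqI:
  assumes W: "subspace W" and "y \<in> W" "\<And>w. w \<in> W \<Longrightarrow> (x - y) \<bullet> w = 0"
  shows "orth_proj W x = y"
  unfolding orth_proj_def
proof (rule the_equality)
  fix z assume z: "z \<in> W \<and> (\<forall>w\<in>W. (x - z) \<bullet> w = 0)"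
  then have "y - z \<in> W" using W assms(2) by (auto intro: subspace_diff)
  then have "(x - z) \<bullet> (y - z) - (x - y) \<bullet> (y - z) = 0" using z assms(3) by auto
  then have "(y - z) \<bullet> (y - z) = 0" by (simp add: inner_diff_left)
  then show "z = y" by simp
qed (use assms in auto)

section \<open>Sections and shadows\<close>

lemma lin_comb_convex_comb:
  "lin_comb k b (convex_comb k l x y) = (1 - l) *\<^sub>R lin_comb k b x + l *\<^sub>R lin_comb k b y"
  by (simp add: lin_comb_def convex_comb_def scaleR_add_left sum.distrib scaleR_sum_right)

lemma lin_comb_upd:
  "lin_comb (Suc k) (b(k := e)) (x(k := t)) = lin_comb k b x + t *\<^sub>R e"
  by (simp add: lin_comb_def)

lemma bounded_line_section:
  fixes e :: "'a::euclidean_space"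
  assumes "bounded Q" "e \<noteq> 0"
  shows "bounded {t. w + t *\<^sub>R e \<in> Q}"
proof -
  obtain r where r: "\<And>x. x \<in> Q \<Longrightarrow> norm x \<le> r" using \<open>bounded Q\<close> by (auto simp: bounded_iff)
  have "norm t \<le> (r + norm w) / norm e" if "w + t *\<^sub>R e \<in> Q" for t
  proof -
    have "norm (t *\<^sub>R e) \<le> norm (w + t *\<^sub>R e) + norm w"
      using norm_triangle_ineq4[of "w + t *\<^sub>R e" w] by simp
    then show ?thesis using r[OF that] \<open>e \<noteq> 0\<close> by (simp add: field_simps)
  qed
  then show ?thesis by (auto simp: bounded_iff)
qed

lemma sets_line_section:
  fixes e :: "'a::euclidean_space"
  assumes "closed Q"
  shows "{t::real. w + t *\<^sub>R e \<in> Q} \<in> sets borel"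
proof -
  have "closed ((\<lambda>t. w + t *\<^sub>R e) -` Q)"
    by (rule closed_vimage[OF \<open>closed Q\<close>]) (auto intro!: continuous_intros)
  then show ?thesis by (simp add: vimage_def)
qed

lemma emeasure_line_section:
  fixes e :: "'a::euclidean_space"
  assumes "closed Q"
  shows "emeasure lborel {t. w + t *\<^sub>R e \<in> Q} = (\<integral>\<^sup>+t. indicator Q (w + t *\<^sub>R e) \<partial>lborel)"
proof -
  have "emeasure lborel {t. w + t *\<^sub>R e \<in> Q} = (\<integral>\<^sup>+t. indicator {t. w + t *\<^sub>R e \<in> Q} t \<partial>lborel)"
    using sets_line_section[OF assms] by simp
  also have "\<dots> = (\<integral>\<^sup>+t. indicator Q (w + t *\<^sub>R e) \<partial>lborel)"
    by (rule nn_integral_cong) (simp add: indicator_def)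
  finally show ?thesis .
qed

lemma measurable_emeasure_line_section:
  fixes b :: "nat \<Rightarrow> 'a::euclidean_space"
  assumes "closed Q"
  shows "(\<lambda>y. emeasure lborel {t. lin_comb m b y + t *\<^sub>R e \<in> Q}) \<in> borel_measurable (Leb m)"
proof -
  have [measurable]: "Q \<in> sets borel" using assms by simp
  show ?thesis unfolding emeasure_line_section[OF assms] by measurable
qed

text \<open>Tonelli in the last coordinate. Applied to a shadow of the body, it gives the volume of
  the shadow as the integral of its section lengths.\<close>

lemma coord_volume_Suc:
  fixes b :: "nat \<Rightarrow> 'a::euclidean_space"
  assumes "closed Q"
  shows "coord_volume (Suc m) (b(m := e)) Q
    = (\<integral>\<^sup>+y. emeasure lborel {t. lin_comb m b y + t *\<^sub>R e \<in> Q} \<partial>Leb m)"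
proof -
  have [measurable]: "Q \<in> sets borel" using assms by simp
  have "coord_volume (Suc m) (b(m := e)) Q
    = (\<integral>\<^sup>+y. \<integral>\<^sup>+t. indicator Q (lin_comb (Suc m) (b(m := e)) (y(m := t))) \<partial>lborel \<partial>Leb m)"
    by (subst coord_volume_eq_nn_integral, simp, rule nn_integral_Leb_Suc) measurable
  then show ?thesis by (simp only: lin_comb_upd emeasure_line_section[OF assms])
qed

text \<open>By one-dimensional Brunn-Minkowski the lengths of parallel sections of a convex set are
  concave over its base \<open>P\<close>, so Berwald's inequality applies to them.\<close>

lemma berwald_line_sections:
  fixes b :: "nat \<Rightarrow> 'a::euclidean_space" and e :: 'a
  assumes Q: "compact Q" "convex Q" and "e \<noteq> 0"
    and P: "P \<in> sets (Leb m)"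
      "\<And>y. y \<in> space (Leb m) \<Longrightarrow> y \<in> P \<longleftrightarrow> (\<exists>t. lin_comb m b y + t *\<^sub>R e \<in> Q)"
  defines "F \<equiv> \<lambda>y. emeasure lborel {t. lin_comb m b y + t *\<^sub>R e \<in> Q}"
  shows "ennreal (m + 2) * (emeasure (Leb m) P * (\<integral>\<^sup>+y. (F y)\<^sup>2 \<partial>Leb m))
      \<le> ennreal (2 * (m + 1)) * (\<integral>\<^sup>+y. F y \<partial>Leb m)\<^sup>2"
proof -
  have cl: "closed Q" using Q(1) by (rule compact_imp_closed)
  have F_fin: "F y < top" for y
    using emeasure_bounded_finite[OF bounded_line_section[OF compact_imp_bounded[OF Q(1)] \<open>e \<noteq> 0\<close>]]
    by (simp add: F_def)
  have [measurable]: "F \<in> borel_measurable (Leb m)"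
    unfolding F_def by (rule measurable_emeasure_line_section[OF cl])
  define f where "f y = enn2real (F y)" for y
  have f0: "0 \<le> f y" for y by (simp add: f_def)
  have Ff: "F y = ennreal (f y)" for y using F_fin[of y] by (simp add: f_def)
  have comb: "(1 - l) * s + l * t \<in> {t. lin_comb m b (convex_comb m l x y) + t *\<^sub>R e \<in> Q}"
    if "0 < l" "l < 1" "lin_comb m b x + s *\<^sub>R e \<in> Q" "lin_comb m b y + t *\<^sub>R e \<in> Q" for l x y s t
  proof -
    have "(1 - l) *\<^sub>R (lin_comb m b x + s *\<^sub>R e) + l *\<^sub>R (lin_comb m b y + t *\<^sub>R e) \<in> Q"
      using that by (intro convexD[OF Q(2)]) auto
    then show ?thesis by (simp add: lin_comb_convex_comb algebra_simps)
  qed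
  have Psp: "y \<in> space (Leb m)" if "y \<in> P" for y using P(1) sets.sets_into_space that by blast
  \<comment> \<open>Off \<open>P\<close> the section is empty and \<open>F\<close> vanishes, so
    integrals over \<open>P\<close> are integrals over the whole space.\<close>
  have zero: "indicator P y * g (F y) = g (F y)" if "y \<in> space (Leb m)" "g 0 = 0" for y and g :: "ennreal \<Rightarrow> ennreal"
    using P(2)[OF that(1)] that(2) by (auto simp: F_def indicator_def)
  have "ennreal (m + 2) * (emeasure (Leb m) P * (\<integral>\<^sup>+y. indicator P y * ennreal ((f y)\<^sup>2) \<partial>Leb m))
      \<le> ennreal (2 * (m + 1)) * (\<integral>\<^sup>+y. indicator P y * ennreal (f y) \<partial>Leb m)\<^sup>2"
  proof (rule berwald_1_2[OF P(1)])
    show "f \<in> borel_measurable (Leb m)" unfolding f_def by measurable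
    fix x assume x: "x \<in> P"
    show "0 \<le> f x" by (simp add: f_def)
    fix y and l :: real assume y: "y \<in> P" and l: "0 < l" "l < 1"
    obtain s t where st: "lin_comb m b x + s *\<^sub>R e \<in> Q" "lin_comb m b y + t *\<^sub>R e \<in> Q"
      using x y P(2)[OF Psp[OF x]] P(2)[OF Psp[OF y]] by auto
    show "convex_comb m l x y \<in> P"
      unfolding P(2)[OF convex_comb_in_space] using comb[OF l st] by auto
    have "ennreal (1 - l) * F x + ennreal l * F y \<le> F (convex_comb m l x y)"
      unfolding F_def
      by (rule brunn_minkowski_real[OF sets_line_section[OF cl] sets_line_section[OF cl] sets_line_section[OF cl] _ _ l])
         (use st comb[OF l] in simp_all, auto)
    then have "ennreal ((1 - l) * f x + l * f y) \<le> ennreal (f (convex_comb m l x y))"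
      using l by (simp add: Ff ennreal_mult f0)
    then show "(1 - l) * f x + l * f y \<le> f (convex_comb m l x y)"
      by (simp add: f0)
  qed
  moreover have "(\<integral>\<^sup>+y. indicator P y * ennreal ((f y)\<^sup>2) \<partial>Leb m) = (\<integral>\<^sup>+y. (F y)\<^sup>2 \<partial>Leb m)"
    using zero[of _ "\<lambda>z. z\<^sup>2"] by (intro nn_integral_cong) (simp add: Ff ennreal_power f0)
  moreover have "(\<integral>\<^sup>+y. indicator P y * ennreal (f y) \<partial>Leb m) = (\<integral>\<^sup>+y. F y \<partial>Leb m)"
    using zero[of _ "\<lambda>z. z"] by (intro nn_integral_cong) (simp add: Ff)
  ultimately show ?thesis by simp
qed

lemma orthonormal_upto_upd:
  assumes "orthonormal_upto k b" "norm e = 1" "\<And>i. i < k \<Longrightarrow> b i \<bullet> e = 0"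
  shows "orthonormal_upto (Suc k) (b(k := e))"
  using assms by (auto simp: orthonormal_upto_def less_Suc_eq norm_eq_1 inner_commute)

lemma proj_volume_nonneg: "0 \<le> proj_volume W K"
  by (simp add: proj_volume_def subspace_volume_def Let_def)

text \<open>Vertical coordinates are taken in the orthonormal frames \<open>(e, u)\<close> and \<open>(g, v)\<close> of the plane
  spanned by \<open>u\<close> and \<open>v\<close>. A planar section of \<open>K\<close> lies in the parallelogram cut out by its two
  shadows, whose area is the product of the shadow lengths divided by \<open>s\<close>.\<close>

lemma coord_volume_le_shadows:
  fixes b :: "nat \<Rightarrow> 'a::euclidean_space"
  assumes K: "closed K" "closed Qu" "closed Qv" and "0 < s"
    and frame: "\<And>p q. p *\<^sub>R e + q *\<^sub>R u = (c * p - s * q) *\<^sub>R g + (s * p + c * q) *\<^sub>R v"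
    and Qu: "\<And>y p q. lin_comb m b y + p *\<^sub>R e + q *\<^sub>R u \<in> K \<Longrightarrow> lin_comb m b y + p *\<^sub>R e \<in> Qu"
    and Qv: "\<And>y p q. lin_comb m b y + p *\<^sub>R g + q *\<^sub>R v \<in> K \<Longrightarrow> lin_comb m b y + p *\<^sub>R g \<in> Qv"
  shows "ennreal s * coord_volume (Suc (Suc m)) (b(m := e, Suc m := u)) K
    \<le> (\<integral>\<^sup>+y. emeasure lborel {t. lin_comb m b y + t *\<^sub>R e \<in> Qu}
          * emeasure lborel {t. lin_comb m b y + t *\<^sub>R g \<in> Qv} \<partial>Leb m)"
proof -
  have [measurable]: "K \<in> sets borel" "Qu \<in> sets borel" "Qv \<in> sets borel" using K by auto
  define Fu where "Fu y = (\<integral>\<^sup>+t. indicator Qu (lin_comb m b y + t *\<^sub>R e) \<partial>lborel)" for y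
  define Fv where "Fv y = (\<integral>\<^sup>+t. indicator Qv (lin_comb m b y + t *\<^sub>R g) \<partial>lborel)" for y
  have [measurable]: "Fu \<in> borel_measurable (Leb m)" "Fv \<in> borel_measurable (Leb m)"
    unfolding Fu_def Fv_def by measurable
  \<comment> \<open>For fixed \<open>y\<close> and \<open>p\<close>, the coordinate along
    \<open>g\<close> is \<open>c * p - s * q\<close>. It moves at speed \<open>s\<close> in
    \<open>q\<close>, and the substitution produces the factor \<open>s\<close>.\<close>
  have inner: "ennreal s * (\<integral>\<^sup>+q. indicator K (lin_comb m b y + p *\<^sub>R e + q *\<^sub>R u) \<partial>lborel)
      \<le> indicator Qu (lin_comb m b y + p *\<^sub>R e) * Fv y" for y p
  proof -
    have "indicator K (lin_comb m b y + p *\<^sub>R e + q *\<^sub>R u) \<le> indicator Qu (lin_comb m b y + p *\<^sub>R e)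
        * (indicator Qv (lin_comb m b y + (c * p + (- s) * q) *\<^sub>R g) :: ennreal)" for q
      using Qu[of y p q] Qv[of y "c * p + (- s) * q" "s * p + c * q"] frame[of p q]
      by (auto simp: indicator_def add.assoc)
    then have "(\<integral>\<^sup>+q. indicator K (lin_comb m b y + p *\<^sub>R e + q *\<^sub>R u) \<partial>lborel)
        \<le> (\<integral>\<^sup>+q. indicator Qu (lin_comb m b y + p *\<^sub>R e)
            * indicator Qv (lin_comb m b y + (c * p + (- s) * q) *\<^sub>R g) \<partial>lborel)"
      by (rule nn_integral_mono)
    also have "\<dots> = indicator Qu (lin_comb m b y + p *\<^sub>R e)
        * (\<integral>\<^sup>+q. indicator Qv (lin_comb m b y + (c * p + (- s) * q) *\<^sub>R g) \<partial>lborel)"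
      by (rule nn_integral_cmult) measurable
    finally have "ennreal s * (\<integral>\<^sup>+q. indicator K (lin_comb m b y + p *\<^sub>R e + q *\<^sub>R u) \<partial>lborel)
        \<le> ennreal s * (indicator Qu (lin_comb m b y + p *\<^sub>R e)
        * (\<integral>\<^sup>+q. indicator Qv (lin_comb m b y + (c * p + (- s) * q) *\<^sub>R g) \<partial>lborel))"
      by (rule mult_left_mono) simp
    also have "\<dots> = indicator Qu (lin_comb m b y + p *\<^sub>R e) * (ennreal \<bar>- s\<bar>
        * (\<integral>\<^sup>+q. indicator Qv (lin_comb m b y + (c * p + (- s) * q) *\<^sub>R g) \<partial>lborel))"
      using \<open>0 < s\<close> by (simp add: mult_ac)
    also have "ennreal \<bar>- s\<bar> * (\<integral>\<^sup>+q. indicator Qv (lin_comb m b y + (c * p + (- s) * q) *\<^sub>R g) \<partial>lborel) = Fv y"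
      unfolding Fv_def using \<open>0 < s\<close>
      by (intro nn_integral_real_affine[where f = "\<lambda>t. indicator Qv (lin_comb m b y + t *\<^sub>R g)", symmetric]) auto
    finally show ?thesis .
  qed
  have "coord_volume (Suc (Suc m)) (b(m := e, Suc m := u)) K
     = (\<integral>\<^sup>+x. \<integral>\<^sup>+q. indicator K (lin_comb (Suc m) (b(m := e)) x + q *\<^sub>R u) \<partial>lborel \<partial>Leb (Suc m))"
    unfolding coord_volume_Suc[OF K(1)] emeasure_line_section[OF K(1)] ..
  also have "\<dots> = (\<integral>\<^sup>+y. \<integral>\<^sup>+p. \<integral>\<^sup>+q. indicator K (lin_comb m b y + p *\<^sub>R e + q *\<^sub>R u) \<partial>lborel \<partial>lborel \<partial>Leb m)"
    by (subst nn_integral_Leb_Suc) (measurable, simp only: lin_comb_upd)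
  finally have "ennreal s * coord_volume (Suc (Suc m)) (b(m := e, Suc m := u)) K
     = (\<integral>\<^sup>+y. \<integral>\<^sup>+p. ennreal s * (\<integral>\<^sup>+q. indicator K (lin_comb m b y + p *\<^sub>R e + q *\<^sub>R u) \<partial>lborel) \<partial>lborel \<partial>Leb m)"
    by (simp add: nn_integral_cmult)
  also have "\<dots> \<le> (\<integral>\<^sup>+y. \<integral>\<^sup>+p. indicator Qu (lin_comb m b y + p *\<^sub>R e) * Fv y \<partial>lborel \<partial>Leb m)"
    by (intro nn_integral_mono inner)
  also have "\<dots> = (\<integral>\<^sup>+y. Fu y * Fv y \<partial>Leb m)"
    unfolding Fu_def by (intro nn_integral_cong nn_integral_multc) measurable
  finally show ?thesis
    by (simp add: Fu_def Fv_def emeasure_line_section[OF K(2)] emeasure_line_section[OF K(3)])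
qed

section \<open>Explicit projections and the proof of the inequality\<close>

lemma compact_linear_image:
  fixes p :: "'a::euclidean_space \<Rightarrow> 'b::euclidean_space"
  shows "linear p \<Longrightarrow> compact K \<Longrightarrow> compact (p ` K)"
  by (intro compact_continuous_image linear_continuous_on) (simp_all add: linear_conv_bounded_linear)

text \<open>Replaces the implicitly defined \<open>orth_proj\<close> by an explicit linear map;
  compactness makes the image Borel.\<close>

lemma proj_volume_eq:
  fixes W :: "'a::euclidean_space set"
  assumes "subspace W" "orthonormal_basis_of W b" "compact K" "linear p"
    and p: "\<And>z. p z \<in> W" "\<And>z w. w \<in> W \<Longrightarrow> (z - p z) \<bullet> w = 0"
  shows "proj_volume W K = enn2real (coord_volume (dim W) b (p ` K))"
proof -
  have "orth_proj W = p"
    using p by (intro ext orth_proj_eqI[OF assms(1)]) auto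
  moreover have "p ` K \<in> sets borel"
    using compact_imp_closed[OF compact_linear_image[OF \<open>linear p\<close> \<open>compact K\<close>]] by simp
  ultimately show ?thesis
    using subspace_volume_eq[OF assms(1,2)] by (simp add: proj_volume_def)
qed

lemma projections_independent_case:
  fixes K :: "'a::euclidean_space set" and u v :: 'a
  assumes K: "compact K" "convex K" and u: "norm u = 1" and v: "norm v = 1"
    and indep: "(u \<bullet> v)\<^sup>2 < 1"
  shows "real DIM('a) / (2 * (real DIM('a) - 1)) * sqrt (1 - (u \<bullet> v)\<^sup>2)
           * measure lebesgue K * proj_volume {x. x \<bullet> u = 0 \<and> x \<bullet> v = 0} K
         \<le> proj_volume {x. x \<bullet> u = 0} K * proj_volume {x. x \<bullet> v = 0} K"
proof -
  \<comment> \<open>Cosine and sine of the angle between \<open>u\<close> and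
    \<open>v\<close>.\<close>
  define c where "c = u \<bullet> v"
  define s where "s = sqrt (1 - c\<^sup>2)"
  have s: "0 < s" "s\<^sup>2 = 1 - c\<^sup>2" using indep by (auto simp: s_def c_def)
  then have ss: "s * s = 1 - c * c" by (simp add: power2_eq_square)
  \<comment> \<open>Gram-Schmidt: \<open>e\<close> is the unit vector of the plane orthogonal to
    \<open>u\<close> on the side of \<open>v\<close>, and \<open>g\<close> is the one orthogonal to
    \<open>v\<close>. The frames \<open>(e, u)\<close> and \<open>(g, v)\<close> differ by a
    rotation.\<close>
  define e where "e = (1 / s) *\<^sub>R (v - c *\<^sub>R u)"
  define g where "g = c *\<^sub>R e - s *\<^sub>R u"
  have uu: "u \<bullet> u = 1" and vv: "v \<bullet> v = 1" using u v by (auto simp: norm_eq_1)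
  have v_eq: "v = c *\<^sub>R u + s *\<^sub>R e" using s(1) by (simp add: e_def)
  have ue: "u \<bullet> e = 0" by (simp add: e_def inner_diff_right uu c_def)
  have eu: "e \<bullet> u = 0" using ue by (simp add: inner_commute)
  have ee: "e \<bullet> e = 1"
  proof -
    have "(v - c *\<^sub>R u) \<bullet> (v - c *\<^sub>R u) = s * s"
      by (simp add: inner_diff_left inner_diff_right uu vv ss inner_commute[of v u] flip: c_def)
    then show ?thesis using s(1) by (simp add: e_def)
  qed
  have gv: "g \<bullet> v = 0"
    by (simp add: g_def v_eq inner_add_left inner_add_right inner_diff_left uu ee ue eu)
  have gg: "g \<bullet> g = 1"
    using ss by (simp add: g_def inner_diff_left inner_diff_right uu ee ue eu)
  have frame: "p *\<^sub>R e + q *\<^sub>R u = (c * p - s * q) *\<^sub>R g + (s * p + c * q) *\<^sub>R v" for p q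
  proof -
    have "(c * p - s * q) *\<^sub>R g + (s * p + c * q) *\<^sub>R v
       = ((c * p - s * q) * c + (s * p + c * q) * s) *\<^sub>R e + ((s * p + c * q) * c - (c * p - s * q) * s) *\<^sub>R u"
      by (simp add: g_def v_eq algebra_simps)
    also have "(c * p - s * q) * c + (s * p + c * q) * s = p * (s * s + c * c)" by (simp add: algebra_simps)
    also have "(s * p + c * q) * c - (c * p - s * q) * s = q * (s * s + c * c)" by (simp add: algebra_simps)
    finally show ?thesis by (simp add: ss)
  qed

  define E where "E = {x. x \<bullet> u = 0 \<and> x \<bullet> v = 0}"
  have E_iff: "x \<in> E \<longleftrightarrow> x \<bullet> u = 0 \<and> x \<bullet> e = 0" for x
    using s(1) by (auto simp: E_def v_eq inner_add_right)
  have E_g: "x \<bullet> g = 0" if "x \<in> E" for x using that E_iff by (simp add: g_def inner_diff_right)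
  have subE: "subspace E" by (auto simp: E_def subspace_def inner_add_left)
  define m where "m = dim E"
  \<comment> \<open>\<open>E\<close> is the orthogonal complement of the plane spanned by the
    orthonormal pair \<open>u\<close>, \<open>e\<close>.\<close>
  have DIM: "DIM('a) = Suc (Suc m)"
  proof -
    have "E = {y \<in> UNIV. \<forall>x\<in>span {u, e}. orthogonal x y}"
    proof (intro set_eqI iffI)
      fix y assume "y \<in> E"
      then have "orthogonal y x" if "x \<in> {u, e}" for x using that E_iff by (auto simp: orthogonal_def)
      then have "orthogonal y x" if "x \<in> span {u, e}" for x
        using that by (rule orthogonal_to_span[rotated])
      then show "y \<in> {y \<in> UNIV. \<forall>x\<in>span {u, e}. orthogonal x y}"
        by (simp add: orthogonal_commute)
    next
      fix y assume "y \<in> {y \<in> UNIV. \<forall>x\<in>span {u, e}. orthogonal x y}"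
      then have "orthogonal u y" "orthogonal e y" by (auto simp: span_base)
      then show "y \<in> E" by (simp add: E_iff orthogonal_def inner_commute)
    qed
    moreover have "dim (span {u, e}) = 2"
    proof -
      have "u \<noteq> e" using ue uu by auto
      moreover have "independent {u, e}"
        using ue uu ee by (intro pairwise_orthogonal_independent) (auto simp: pairwise_def orthogonal_def inner_commute)
      ultimately show ?thesis using dim_eq_card_independent[of "{u, e}"] by simp
    qed
    ultimately show ?thesis
      using dim_subspace_orthogonal_to_vectors[of "span {u, e}" UNIV] by (simp add: m_def)
  qed
  obtain b where b: "orthonormal_basis_of E b" using orthonormal_basis_of_exists[OF subE] by blast
  have bE: "b i \<in> E" if "i < m" for i using b that by (simp add: orthonormal_basis_of_iff m_def)
  have onb: "orthonormal_upto m b" using b by (simp add: orthonormal_basis_of_iff m_def)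
  have LE: "lin_comb m b y \<in> E" for y
    using range_lin_comb[OF subE b] by (auto simp: m_def)

  \<comment> \<open>One basis of \<open>E\<close> is completed by \<open>e\<close> to a basis of the
    hyperplane of \<open>u\<close>, and by \<open>g\<close> for \<open>v\<close>, so both shadows
    share the coordinates \<open>y\<close>.\<close>
  have hyper: "orthonormal_basis_of {x. x \<bullet> a = 0} (b(m := d)) \<and> dim {x. x \<bullet> a = 0} = Suc m"
    if "norm a = 1" "norm d = 1" "d \<bullet> a = 0" "\<And>x. x \<in> E \<Longrightarrow> x \<bullet> a = 0" "\<And>x. x \<in> E \<Longrightarrow> x \<bullet> d = 0" for a d
  proof -
    have "a \<noteq> 0" using that(1) by auto
    then have "dim {x. x \<bullet> a = 0} = Suc m"
      using dim_hyperplane[of a] DIM by (simp add: inner_commute)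
    moreover have "orthonormal_upto (Suc m) (b(m := d))"
      using that bE by (intro orthonormal_upto_upd[OF onb]) auto
    ultimately show ?thesis using that bE by (auto simp: orthonormal_basis_of_iff less_Suc_eq)
  qed
  have nrm: "norm e = 1" "norm g = 1" using ee gg by (auto simp: norm_eq_1)
  have "orthonormal_basis_of {x. x \<bullet> u = 0} (b(m := e)) \<and> dim {x. x \<bullet> u = 0} = Suc m"
    by (rule hyper[OF u nrm(1) eu]) (simp_all add: E_iff)
  then have hu: "orthonormal_basis_of {x. x \<bullet> u = 0} (b(m := e))" "dim {x. x \<bullet> u = 0} = Suc m"
    by simp_all
  have "orthonormal_basis_of {x. x \<bullet> v = 0} (b(m := g)) \<and> dim {x. x \<bullet> v = 0} = Suc m"
    by (rule hyper[OF v nrm(2) gv]) (simp_all add: E_g E_def)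
  then have hv: "orthonormal_basis_of {x. x \<bullet> v = 0} (b(m := g))" "dim {x. x \<bullet> v = 0} = Suc m"
    by simp_all
  have sub: "subspace {x. x \<bullet> a = 0}" for a :: 'a by (auto simp: subspace_def inner_add_left)

  define pr where "pr a z = z - (z \<bullet> a) *\<^sub>R a" for a z :: 'a
  have lin: "linear (pr a)" for a
    unfolding pr_def by (intro linearI) (auto simp: algebra_simps inner_add_left)
  have hp: "proj_volume {x. x \<bullet> a = 0} K = enn2real (coord_volume (Suc m) (b(m := d)) (pr a ` K))"
    if "orthonormal_basis_of {x. x \<bullet> a = 0} (b(m := d))" "dim {x. x \<bullet> a = 0} = Suc m" "norm a = 1" for a d
  proof -
    have "a \<bullet> a = 1" using that by (simp add: norm_eq_1)
    then have "pr a z \<in> {x. x \<bullet> a = 0}" "w \<in> {x. x \<bullet> a = 0} \<Longrightarrow> (z - pr a z) \<bullet> w = 0" for z w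
      by (simp_all add: pr_def inner_diff_left inner_commute[of a w])
    then show ?thesis
      using proj_volume_eq[OF sub that(1) K(1) lin[of a]] that(2) by simp
  qed
  define Qu where "Qu = pr u ` K"
  define Qv where "Qv = pr v ` K"
  have Q: "compact Qu" "convex Qu" "compact Qv" "convex Qv"
    unfolding Qu_def Qv_def using K lin
    by (auto intro: compact_linear_image convex_linear_image)
  \<comment> \<open>As \<open>e\<close> is orthogonal to \<open>u\<close>, removing both components
    in turn is the projection onto \<open>E\<close>.\<close>
  define pE where "pE z = pr e (pr u z)" for z
  have linE: "linear pE" unfolding pE_def using linear_compose[OF lin lin, unfolded o_def] .
  have pE_eq: "pE z = z - (z \<bullet> u) *\<^sub>R u - (z \<bullet> e) *\<^sub>R e" for z
    by (simp add: pE_def pr_def inner_diff_left ue)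
  have vE: "proj_volume E K = enn2real (coord_volume m b (pE ` K))"
    unfolding m_def
  proof (rule proj_volume_eq[OF subE b K(1) linE])
    fix z show "pE z \<in> E"
      by (simp add: E_iff pE_eq inner_diff_left uu ee ue eu)
    fix w assume "w \<in> E"
    then show "(z - pE z) \<bullet> w = 0" by (simp add: E_iff pE_eq inner_add_left inner_add_right inner_commute[of _ w])
  qed
  have QE: "compact (pE ` K)" using compact_linear_image[OF linE K(1)] .

  define P where "P = {y \<in> space (Leb m). lin_comb m b y \<in> pE ` K}"
  have P: "P \<in> sets (Leb m)"
    unfolding P_def using QE by (intro measurable_sets_Collect[OF measurable_lin_comb]) (auto simp: compact_imp_closed)
  have mem: "w + p *\<^sub>R d \<in> pr a ` K \<longleftrightarrow> (\<exists>q. w + p *\<^sub>R d + q *\<^sub>R a \<in> K)"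
    if "norm a = 1" "w \<bullet> a = 0" "d \<bullet> a = 0" for w p d a
  proof
    assume "w + p *\<^sub>R d \<in> pr a ` K"
    then obtain z where "z \<in> K" "w + p *\<^sub>R d = z - (z \<bullet> a) *\<^sub>R a" by (auto simp: pr_def)
    then show "\<exists>q. w + p *\<^sub>R d + q *\<^sub>R a \<in> K" by (intro exI[of _ "z \<bullet> a"]) simp
  next
    assume "\<exists>q. w + p *\<^sub>R d + q *\<^sub>R a \<in> K"
    then obtain q where "w + p *\<^sub>R d + q *\<^sub>R a \<in> K" ..
    moreover have "pr a (w + p *\<^sub>R d + q *\<^sub>R a) = w + p *\<^sub>R d"
      using that by (simp add: pr_def inner_add_left norm_eq_1)
    ultimately show "w + p *\<^sub>R d \<in> pr a ` K" by (metis image_eqI)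
  qed
  have memE: "w \<in> pE ` K \<longleftrightarrow> (\<exists>p q. w + p *\<^sub>R e + q *\<^sub>R u \<in> K)" if "w \<in> E" for w
  proof
    assume "w \<in> pE ` K"
    then obtain z where "z \<in> K" "w = z - (z \<bullet> u) *\<^sub>R u - (z \<bullet> e) *\<^sub>R e" by (auto simp: pE_eq)
    then show "\<exists>p q. w + p *\<^sub>R e + q *\<^sub>R u \<in> K"
      by (intro exI[of _ "z \<bullet> e"] exI[of _ "z \<bullet> u"]) simp
  next
    assume "\<exists>p q. w + p *\<^sub>R e + q *\<^sub>R u \<in> K"
    then obtain p q where "w + p *\<^sub>R e + q *\<^sub>R u \<in> K" by blast
    moreover have "pE (w + p *\<^sub>R e + q *\<^sub>R u) = w"
      using that by (simp add: pE_eq E_iff inner_add_left uu ee ue eu)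
    ultimately show "w \<in> pE ` K" by (metis image_eqI)
  qed
  have memu: "lin_comb m b y + p *\<^sub>R e \<in> Qu \<longleftrightarrow> (\<exists>q. lin_comb m b y + p *\<^sub>R e + q *\<^sub>R u \<in> K)" for y p
    unfolding Qu_def using mem[of u "lin_comb m b y" e p] u eu LE[of y] by (simp add: E_iff)
  have memv: "lin_comb m b y + p *\<^sub>R g \<in> Qv \<longleftrightarrow> (\<exists>q. lin_comb m b y + p *\<^sub>R g + q *\<^sub>R v \<in> K)" for y p
    unfolding Qv_def using mem[of v "lin_comb m b y" g p] v gv LE[of y] by (simp add: E_def)
  have Pu: "y \<in> P \<longleftrightarrow> (\<exists>t. lin_comb m b y + t *\<^sub>R e \<in> Qu)" if "y \<in> space (Leb m)" for y
    using that memE[OF LE] memu by (simp add: P_def)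
  \<comment> \<open>Both shadows lie over the same base \<open>P\<close>: the two frames span the
    same plane, so a fibre meets \<open>K\<close> in one frame exactly when it does in the
    other.\<close>
  have Pv: "y \<in> P \<longleftrightarrow> (\<exists>t. lin_comb m b y + t *\<^sub>R g \<in> Qv)" if "y \<in> space (Leb m)" for y
  proof -
    have "(\<exists>p q. lin_comb m b y + p *\<^sub>R e + q *\<^sub>R u \<in> K) \<longleftrightarrow> (\<exists>t r. lin_comb m b y + t *\<^sub>R g + r *\<^sub>R v \<in> K)"
    proof
      assume "\<exists>p q. lin_comb m b y + p *\<^sub>R e + q *\<^sub>R u \<in> K"
      then show "\<exists>t r. lin_comb m b y + t *\<^sub>R g + r *\<^sub>R v \<in> K"
        using frame by (metis add.assoc)
    next
      assume "\<exists>t r. lin_comb m b y + t *\<^sub>R g + r *\<^sub>R v \<in> K"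
      then obtain t r where "lin_comb m b y + t *\<^sub>R g + r *\<^sub>R v \<in> K" by blast
      moreover have "t *\<^sub>R g + r *\<^sub>R v = (c * t + s * r) *\<^sub>R e + (c * r - s * t) *\<^sub>R u"
        by (simp add: g_def v_eq algebra_simps)
      ultimately show "\<exists>p q. lin_comb m b y + p *\<^sub>R e + q *\<^sub>R u \<in> K"
        by (metis add.assoc)
    qed
    then show ?thesis using that memE[OF LE] memv by (simp add: P_def)
  qed

  define Fu where "Fu y = emeasure lborel {t. lin_comb m b y + t *\<^sub>R e \<in> Qu}" for y
  define Fv where "Fv y = emeasure lborel {t. lin_comb m b y + t *\<^sub>R g \<in> Qv}" for y
  have cl: "closed K" "closed Qu" "closed Qv" using K Q by (auto intro: compact_imp_closed)
  have [measurable]: "Fu \<in> borel_measurable (Leb m)" "Fv \<in> borel_measurable (Leb m)"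
    unfolding Fu_def Fv_def by (auto intro!: measurable_emeasure_line_section cl)
  \<comment> \<open>With \<open>m + 2\<close> the dimension \<open>n\<close>, the quotient
    \<open>k / j\<close> is the constant \<open>n / (2 (n - 1))\<close>.\<close>
  define k where "k = real (m + 2)"
  define j where "j = real (2 * (m + 1))"
  define V where "V = enn2real (emeasure (Leb m) P)"
  define A where "A = enn2real (coord_volume (Suc m) (b(m := e)) Qu)"
  define B where "B = enn2real (coord_volume (Suc m) (b(m := g)) Qv)"
  define N where "N = measure lebesgue K"
  have V: "emeasure (Leb m) P = ennreal V"
    using coord_volume_bounded_finite[OF onb compact_imp_bounded[OF QE]]
    by (simp add: V_def P_def coord_volume_def)
  have Iu: "(\<integral>\<^sup>+y. Fu y \<partial>Leb m) = ennreal A"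
    using coord_volume_bounded_finite[OF _ compact_imp_bounded[OF Q(1)], of "Suc m" "b(m := e)"] hu
    by (simp add: A_def Fu_def coord_volume_Suc[OF cl(2)] orthonormal_basis_of_iff)
  have Iv: "(\<integral>\<^sup>+y. Fv y \<partial>Leb m) = ennreal B"
    using coord_volume_bounded_finite[OF _ compact_imp_bounded[OF Q(3)], of "Suc m" "b(m := g)"] hv
    by (simp add: B_def Fv_def coord_volume_Suc[OF cl(3)] orthonormal_basis_of_iff)
  have nonneg: "0 \<le> k" "0 \<le> j" "0 \<le> V" "0 \<le> A" "0 \<le> B" "0 \<le> N"
    by (auto simp: k_def j_def V_def A_def B_def N_def)
  have Ku: "ennreal k * (ennreal V * (\<integral>\<^sup>+y. (Fu y)\<^sup>2 \<partial>Leb m)) \<le> ennreal j * (ennreal A)\<^sup>2"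
    using berwald_line_sections[OF Q(1,2) _ P Pu] ee
    unfolding k_def j_def V[symmetric] Iu[symmetric] Fu_def by fastforce
  have Kv: "ennreal k * (ennreal V * (\<integral>\<^sup>+y. (Fv y)\<^sup>2 \<partial>Leb m)) \<le> ennreal j * (ennreal B)\<^sup>2"
    using berwald_line_sections[OF Q(3,4) _ P Pv] gg
    unfolding k_def j_def V[symmetric] Iv[symmetric] Fv_def by fastforce

  have "orthonormal_upto (Suc (Suc m)) (b(m := e, Suc m := u))"
  proof (rule orthonormal_upto_upd[OF _ u])
    show "orthonormal_upto (Suc m) (b(m := e))" using hu by (simp add: orthonormal_basis_of_iff)
    show "(b(m := e)) i \<bullet> u = 0" if "i < Suc m" for i
      using that bE[of i] eu by (cases "i = m") (simp_all add: E_iff)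
  qed
  then have "emeasure lborel K = coord_volume (Suc (Suc m)) (b(m := e, Suc m := u)) K"
    using emeasure_lborel_eq_coord_volume[of "b(m := e, Suc m := u)" K] DIM cl(1) by simp
  moreover have "emeasure lborel K = ennreal N"
    using emeasure_bounded_finite[OF compact_imp_bounded[OF K(1)]] cl(1)
    by (simp add: N_def measure_def measure_completion)
  ultimately have "ennreal (s * N) \<le> (\<integral>\<^sup>+y. Fu y * Fv y \<partial>Leb m)"
    using coord_volume_le_shadows[OF cl s(1) frame, of m b] memu memv s(1) nonneg
    unfolding Fu_def Fv_def by (simp add: ennreal_mult) blast
  then have "(ennreal (s * N))\<^sup>2 \<le> (\<integral>\<^sup>+y. Fu y * Fv y \<partial>Leb m)\<^sup>2" by (rule power_mono) simp
  also have "\<dots> \<le> (\<integral>\<^sup>+y. (Fu y)\<^sup>2 \<partial>Leb m) * (\<integral>\<^sup>+y. (Fv y)\<^sup>2 \<partial>Leb m)"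
    by (rule Cauchy_Schwarz_nn_integral) measurable
  \<comment> \<open>The factor \<open>(k V)^2\<close> supplies one \<open>k V\<close> to each of the
    two Berwald bounds, which avoids dividing by the volume \<open>V\<close>.\<close>
  finally have "(ennreal k * ennreal V)\<^sup>2 * (ennreal (s * N))\<^sup>2
      \<le> (ennreal k * ennreal V)\<^sup>2 * ((\<integral>\<^sup>+y. (Fu y)\<^sup>2 \<partial>Leb m) * (\<integral>\<^sup>+y. (Fv y)\<^sup>2 \<partial>Leb m))"
    by (rule mult_left_mono) simp
  also have "\<dots> = (ennreal k * (ennreal V * (\<integral>\<^sup>+y. (Fu y)\<^sup>2 \<partial>Leb m)))
      * (ennreal k * (ennreal V * (\<integral>\<^sup>+y. (Fv y)\<^sup>2 \<partial>Leb m)))"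
    by (simp only: power2_eq_square mult_ac)
  also have "\<dots> \<le> (ennreal j * (ennreal A)\<^sup>2) * (ennreal j * (ennreal B)\<^sup>2)"
    by (rule mult_mono[OF Ku Kv]) auto
  also have "\<dots> = (ennreal j * (ennreal A * ennreal B))\<^sup>2"
    by (simp only: power2_eq_square mult_ac)
  finally have "(ennreal k * ennreal V * ennreal (s * N))\<^sup>2 \<le> (ennreal j * (ennreal A * ennreal B))\<^sup>2"
    by (simp only: power_mult_distrib)
  moreover have "ennreal j * (ennreal A * ennreal B) = ennreal (j * (A * B))"
    using nonneg by (simp add: ennreal_mult)
  moreover have "ennreal k * ennreal V * ennreal (s * N) = ennreal (k * V * (s * N))"
    using nonneg s(1) by (simp add: ennreal_mult)
  ultimately have "ennreal ((k * V * (s * N))\<^sup>2) \<le> ennreal ((j * (A * B))\<^sup>2)"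
    using nonneg s(1) by (simp add: ennreal_power)
  then have "(k * V * (s * N))\<^sup>2 \<le> (j * (A * B))\<^sup>2"
    by (subst (asm) ennreal_le_iff) auto
  then have main: "k * V * (s * N) \<le> j * (A * B)"
    by (rule power2_le_imp_le) (simp add: nonneg)
  have "real DIM('a) / (2 * (real DIM('a) - 1)) = k / j"
    by (simp add: DIM k_def j_def)
  then have "real DIM('a) / (2 * (real DIM('a) - 1)) * s * N * V = k * V * (s * N) / j" by simp
  also have "\<dots> \<le> A * B" using main by (simp add: j_def pos_divide_le_eq mult.commute)
  finally show ?thesis
    unfolding hp[OF hu u] hp[OF hv v] vE[unfolded E_def] A_def B_def V_def P_def N_def s_def c_def Qu_def Qv_def coord_volume_def .
qed

theorem theorem1p4:
  fixes K :: "'a::euclidean_space set" and u v :: 'a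
  assumes "DIM('a) \<ge> 3"
    and "convex_body K"
    and "norm u = 1" and "norm v = 1"
  shows "proj_volume {x. x \<bullet> u = 0} K * proj_volume {x. x \<bullet> v = 0} K
         \<ge> real DIM('a) / (2 * (real DIM('a) - 1)) * sqrt (1 - (u \<bullet> v)\<^sup>2)
           * measure lebesgue K * proj_volume {x. x \<bullet> u = 0 \<and> x \<bullet> v = 0} K"
proof (cases "(u \<bullet> v)\<^sup>2 < 1")
  case True
  then show ?thesis
    using projections_independent_case assms unfolding convex_body_def by blast
next
  case False
  \<comment> \<open>For parallel directions the square root is 0, so the lower bound is 0 and the
    product of volumes is nonnegative.\<close>
  have "\<bar>u \<bullet> v\<bar> \<le> 1" using Cauchy_Schwarz_ineq2[of u v] assms by simp
  then have "(u \<bullet> v)\<^sup>2 \<le> 1" by (simp add: abs_square_le_1)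
  with False have "(u \<bullet> v)\<^sup>2 = 1" by simp
  then show ?thesis by (simp add: proj_volume_nonneg)
qed

end
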